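(* Let $\Omega\subset[0,\frac{\pi}{4})$ be a bad set of directions, and let $\mathcal{B}\subset\mathcal{R}_\Omega$ be a family such that for every $\omega\in\Omega$ $$\inf_{r\in\mathcal{B},\ \omega_r=\omega} e_r=0 .$$ Then $M_{\mathcal{B}}$ is a bad operator, i.e. $M_{\mathcal{B}}$ is unbounded on $L^p(\mathbb{R}^2)$ for every $1<p<\infty$.
   Context: $\mathcal{R}$ is the collection of all (non-degenerate) rectangles in $\mathbb{R}^2$. For $r\in\mathcal{R}$, its orientation $\omega_r\in[0,\pi)$ is the angle its longest side makes with the $x$-axis, and its eccentricity $e_r\in(0,1]$ is the ratio of its shortest side to its longest side. For a non-empty family $\mathcal{B}\subset\mathcal{R}$, put $\mathcal{B}^*=\{\vec t+hr:\vec t\in\mathbb{R}^2,\ h>0,\ r\in\mathcal{B}\}$ and, for $f\in L^1_{loc}(\mathbb{R}^2)$ and $x\in\mathbb{R}^2$, $$M_{\mathcal{B}}f(x)=\sup_{x\in r\in\mathcal{B}^*}\frac1{|r|}\int_r|f| ,$$ the supremum being over all $r\in\mathcal{B}^*$ containing $x$. Put $\|M_{\mathcal{B}}\|_p=\sup_{\|f\|_p=1}\|M_{\mathcal{B}}f\|_p$; $M_{\mathcal{B}}$ is bounded on $L^p(\mathbb{R}^2)$ if $\|M_{\mathcal{B}}\|_p<\infty$ and unbounded otherwise. $M_{\mathcal{B}}$ is called a bad operator if it is unbounded on $L^p(\mathbb{R}^2)$ for every $1<p<\infty$. For $\Omega\subset[0,\pi)$ put $\mathcal{R}_\Omega=\{r\in\mathcal{R}:\omega_r\in\Omega\}$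 and $M_\Omega=M_{\mathcal{R}_\Omega}$. $\Omega$ is a bad set of directions if $M_\Omega$ is a bad operator. *)

theory Defs
  imports "HOL-Analysis.Analysis"
begin

type_synonym plane = "real \<times> real"

definition dir :: "real \<Rightarrow> plane" where
  "dir \<theta> = (cos \<theta>, sin \<theta>)"

text \<open>The closed rectangle with a vertex \<open>c\<close>, a side of length \<open>a\<close> at angle \<open>\<theta>\<close>
  to the \<open>x\<close>-axis, and a side of length \<open>b\<close> orthogonal to it.\<close>

definition rect :: "plane \<Rightarrow> real \<Rightarrow> real \<Rightarrow> real \<Rightarrow> plane set" where
  "rect c \<theta> a b = {c + s *\<^sub>R dir \<theta> + t *\<^sub>R dir (\<theta> + pi / 2) | s t. 0 \<le> s \<and> s \<le> a \<and> 0 \<le> t \<and> t \<le> b}"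

definition rectangles :: "plane set set" where
  "rectangles = {rect c \<theta> a b | c \<theta> a b. 0 \<le> \<theta> \<and> \<theta> < pi \<and> 0 < b \<and> b \<le> a}"

text \<open>Every rectangle that is not a square has exactly one angle in \<open>[0, \<pi>)\<close> as required
  below.  A square has two of them, differing by \<open>\<pi> / 2\<close>; by convention its orientation is the
  one in \<open>[0, \<pi> / 2)\<close>.\<close>

definition orientation :: "plane set \<Rightarrow> real" where
  "orientation r = (LEAST \<omega>. 0 \<le> \<omega> \<and> \<omega> < pi \<and> (\<exists>c a b. 0 < b \<and> b \<le> a \<and> r = rect c \<omega> a b))"

definition eccentricity :: "plane set \<Rightarrow> real" where
  "eccentricity r = (THE e. \<exists>c \<theta> a b. 0 < b \<and> b \<le> a \<and> r = rect c \<theta> a b \<and> e = b / a)"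

definition homothets :: "plane set set \<Rightarrow> plane set set" where
  "homothets B = {(\<lambda>x. t + h *\<^sub>R x) ` r | t h r. 0 < h \<and> r \<in> B}"

definition maximal_op :: "plane set set \<Rightarrow> (plane \<Rightarrow> real) \<Rightarrow> plane \<Rightarrow> ennreal" where
  "maximal_op B f x =
     (SUP r \<in> {r \<in> homothets B. x \<in> r}.
        (\<integral>\<^sup>+ y \<in> r. ennreal \<bar>f y\<bar> \<partial>lebesgue) / emeasure lebesgue r)"

text \<open>Real powers on \<open>[0, \<infinity>]\<close>, for exponents \<open>p > 0\<close>.\<close>

definition ennreal_powr :: "ennreal \<Rightarrow> real \<Rightarrow> ennreal" where
  "ennreal_powr x p = (if x = \<infinity> then \<infinity> else ennreal (enn2real x powr p))"

definition Lp_norm :: "real \<Rightarrow> (plane \<Rightarrow> ennreal) \<Rightarrow> ennreal" where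
  "Lp_norm p g = ennreal_powr (\<integral>\<^sup>+ x. ennreal_powr (g x) p \<partial>lebesgue) (1 / p)"

definition maximal_op_norm :: "real \<Rightarrow> plane set set \<Rightarrow> ennreal" where
  "maximal_op_norm p B =
     (SUP f \<in> {f \<in> borel_measurable lebesgue. Lp_norm p (\<lambda>x. ennreal \<bar>f x\<bar>) = 1}.
        Lp_norm p (maximal_op B f))"

definition bounded_on_Lp :: "real \<Rightarrow> plane set set \<Rightarrow> bool" where
  "bounded_on_Lp p B \<longleftrightarrow> maximal_op_norm p B < \<infinity>"

definition bad_maximal_op :: "plane set set \<Rightarrow> bool" where
  "bad_maximal_op B \<longleftrightarrow> (\<forall>p. 1 < p \<longrightarrow> \<not> bounded_on_Lp p B)"

definition rectangles_along :: "real set \<Rightarrow> plane set set" where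
  "rectangles_along \<Omega> = {r \<in> rectangles. orientation r \<in> \<Omega>}"

definition bad_directions :: "real set \<Rightarrow> bool" where
  "bad_directions \<Omega> \<longleftrightarrow> bad_maximal_op (rectangles_along \<Omega>)"


text \<open>Well-definedness of \<^const>\<open>orientation\<close> and \<^const>\<open>eccentricity\<close>.\<close>

lemma inner_dir: "dir \<alpha> \<bullet> dir \<beta> = cos (\<alpha> - \<beta>)"
  by (simp add: dir_def cos_diff)

lemma rect_width_le:
  assumes "x \<in> rect c \<theta> a b" "y \<in> rect c \<theta> a b"
  shows "(x - y) \<bullet> dir \<phi> \<le> a * \<bar>cos (\<theta> - \<phi>)\<bar> + b * \<bar>sin (\<theta> - \<phi>)\<bar>"
proof -
  obtain s t where x: "x = c + s *\<^sub>R dir \<theta> + t *\<^sub>R dir (\<theta> + pi / 2)"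
    and st: "0 \<le> s" "s \<le> a" "0 \<le> t" "t \<le> b"
    using assms(1) by (auto simp: rect_def)
  obtain s' t' where y: "y = c + s' *\<^sub>R dir \<theta> + t' *\<^sub>R dir (\<theta> + pi / 2)"
    and st': "0 \<le> s'" "s' \<le> a" "0 \<le> t'" "t' \<le> b"
    using assms(2) by (auto simp: rect_def)
  have "cos (\<theta> + pi / 2 - \<phi>) = - sin (\<theta> - \<phi>)"
    using minus_sin_cos_eq[of "\<theta> - \<phi>"] by (simp add: algebra_simps)
  then have "(x - y) \<bullet> dir \<phi> = (s - s') * cos (\<theta> - \<phi>) + (t' - t) * sin (\<theta> - \<phi>)"
    by (simp add: x y inner_left_distrib inner_diff_left inner_dir algebra_simps)
  moreover have "(s - s') * cos (\<theta> - \<phi>) \<le> \<bar>s - s'\<bar> * \<bar>cos (\<theta> - \<phi>)\<bar>"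
    by (metis abs_ge_self abs_mult)
  moreover have "\<bar>s - s'\<bar> * \<bar>cos (\<theta> - \<phi>)\<bar> \<le> a * \<bar>cos (\<theta> - \<phi>)\<bar>"
    using st st' by (intro mult_right_mono) auto
  moreover have "(t' - t) * sin (\<theta> - \<phi>) \<le> \<bar>t' - t\<bar> * \<bar>sin (\<theta> - \<phi>)\<bar>"
    by (metis abs_ge_self abs_mult)
  moreover have "\<bar>t' - t\<bar> * \<bar>sin (\<theta> - \<phi>)\<bar> \<le> b * \<bar>sin (\<theta> - \<phi>)\<bar>"
    using st st' by (intro mult_right_mono) auto
  ultimately show ?thesis by linarith
qed

lemma rect_width_attained:
  assumes "0 \<le> a" "0 \<le> b"
  shows "\<exists>x\<in>rect c \<theta> a b. \<exists>y\<in>rect c \<theta> a b.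
           (x - y) \<bullet> dir \<phi> = a * \<bar>cos (\<theta> - \<phi>)\<bar> + b * \<bar>sin (\<theta> - \<phi>)\<bar>"
proof -
  define C S where "C = cos (\<theta> - \<phi>)" and "S = sin (\<theta> - \<phi>)"
  define P where "P s t = c + s *\<^sub>R dir \<theta> + t *\<^sub>R dir (\<theta> + pi / 2)" for s t
  have "cos (\<theta> + pi / 2 - \<phi>) = - S"
    using minus_sin_cos_eq[of "\<theta> - \<phi>"] by (simp add: S_def algebra_simps)
  then have diff: "(P s t - P s' t') \<bullet> dir \<phi> = (s - s') * C + (t' - t) * S" for s t s' t'
    by (simp add: P_def inner_left_distrib inner_diff_left inner_dir C_def algebra_simps)
  have mem: "P s t \<in> rect c \<theta> a b" if "s \<in> {0, a}" "t \<in> {0, b}" for s t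
    using that assms by (auto simp: rect_def P_def)
  define s s' t t' where "s = (if C \<ge> 0 then a else 0)" and "s' = (if C \<ge> 0 then 0 else a)"
    and "t = (if S \<ge> 0 then 0 else b)" and "t' = (if S \<ge> 0 then b else 0)"
  have "(P s t - P s' t') \<bullet> dir \<phi> = a * \<bar>C\<bar> + b * \<bar>S\<bar>"
    by (simp add: diff s_def s'_def t_def t'_def)
  moreover have "P s t \<in> rect c \<theta> a b" "P s' t' \<in> rect c \<theta> a b"
    by (auto intro!: mem simp: s_def s'_def t_def t'_def)
  ultimately show ?thesis by (auto simp: C_def S_def)
qed

lemma rect_eq_width:
  assumes "rect c \<theta> a b = rect c' \<theta>' a' b'" "0 \<le> a" "0 \<le> b" "0 \<le> a'" "0 \<le> b'"
  shows "a * \<bar>cos (\<theta> - \<phi>)\<bar> + b * \<bar>sin (\<theta> - \<phi>)\<bar> = a' * \<bar>cos (\<theta>' - \<phi>)\<bar> + b' * \<bar>sin (\<theta>' - \<phi>)\<bar>"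
proof (rule antisym)
  show "a * \<bar>cos (\<theta> - \<phi>)\<bar> + b * \<bar>sin (\<theta> - \<phi>)\<bar> \<le> a' * \<bar>cos (\<theta>' - \<phi>)\<bar> + b' * \<bar>sin (\<theta>' - \<phi>)\<bar>"
    using rect_width_attained[OF assms(2,3), of c \<theta> \<phi>] rect_width_le[of _ c' \<theta>' a' b' _ \<phi>]
    unfolding assms(1) by fastforce
  show "a' * \<bar>cos (\<theta>' - \<phi>)\<bar> + b' * \<bar>sin (\<theta>' - \<phi>)\<bar> \<le> a * \<bar>cos (\<theta> - \<phi>)\<bar> + b * \<bar>sin (\<theta> - \<phi>)\<bar>"
    using rect_width_attained[OF assms(4,5), of c' \<theta>' \<phi>] rect_width_le[of _ c \<theta> a b _ \<phi>]
    unfolding assms(1) by fastforce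
qed

lemma rect_unique:
  assumes eq: "rect c \<theta> a b = rect c' \<theta>' a' b'" and ab: "0 < b" "b \<le> a" "0 < b'" "b' \<le> a'"
  shows "a = a'" "b = b'" "a = b \<or> sin (\<theta> - \<theta>') = 0" "sin (\<theta> - \<theta>') * cos (\<theta> - \<theta>') = 0"
proof -
  define C S where "C = \<bar>cos (\<theta> - \<theta>')\<bar>" and "S = \<bar>sin (\<theta> - \<theta>')\<bar>"
  have one: "C\<^sup>2 + S\<^sup>2 = 1" by (simp add: C_def S_def)
  note W = rect_eq_width[OF eq]
  have 1: "a * C + b * S = a'"
    using W[of \<theta>'] ab by (simp add: C_def S_def)
  have 2: "a = a' * C + b' * S"
  proof -
    have "\<bar>cos (\<theta>' - \<theta>)\<bar> = C" "\<bar>sin (\<theta>' - \<theta>)\<bar> = S"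
      unfolding C_def S_def
      using cos_minus[of "\<theta> - \<theta>'"] sin_minus[of "\<theta> - \<theta>'"] by simp_all
    then show ?thesis using W[of \<theta>] ab by simp
  qed
  have 3: "a * S + b * C = b'"
  proof -
    have "cos (\<theta> - (\<theta>' + pi / 2)) = sin (\<theta> - \<theta>')" "sin (\<theta> - (\<theta>' + pi / 2)) = - cos (\<theta> - \<theta>')"
      by (simp_all add: diff_diff_eq[symmetric] cos_diff[of _ "pi / 2"] sin_diff[of _ "pi / 2"])
    then show ?thesis using W[of "\<theta>' + pi / 2"] ab by (simp add: C_def S_def)
  qed
  have "a = a * (C\<^sup>2 + S\<^sup>2) + 2 * b * (C * S)"
    by (subst 2, subst 1[symmetric], subst 3[symmetric]) (simp add: algebra_simps power2_eq_square)
  with one ab have CS: "C * S = 0" by simp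
  then show "sin (\<theta> - \<theta>') * cos (\<theta> - \<theta>') = 0" by (auto simp: C_def S_def)
  have "S = 0 \<and> C = 1 \<or> C = 0 \<and> S = 1"
  proof -
    have "C \<ge> 0" "S \<ge> 0" by (simp_all add: C_def S_def)
    with CS one show ?thesis by (auto simp: power2_eq_1_iff)
  qed
  then have *: "a = a' \<and> b = b' \<and> (a = b \<or> S = 0)"
    using 1 3 ab by auto
  then show "a = a'" "b = b'" "a = b \<or> sin (\<theta> - \<theta>') = 0" by (auto simp: S_def)
qed

lemma eccentricity_rect:
  assumes "0 < b" "b \<le> a"
  shows "eccentricity (rect c \<theta> a b) = b / a"
  unfolding eccentricity_def
proof (rule the_equality)
  show "\<exists>c' \<theta>' a' b'. 0 < b' \<and> b' \<le> a' \<and> rect c \<theta> a b = rect c' \<theta>' a' b' \<and> b / a = b' / a'"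
    using assms by blast
next
  fix e
  assume "\<exists>c' \<theta>' a' b'. 0 < b' \<and> b' \<le> a' \<and> rect c \<theta> a b = rect c' \<theta>' a' b' \<and> e = b' / a'"
  then obtain c' \<theta>' a' b' where r: "rect c \<theta> a b = rect c' \<theta>' a' b'" "0 < b'" "b' \<le> a'"
    and e: "e = b' / a'" by blast
  show "e = b / a" using rect_unique(1,2)[OF r(1) assms r(2,3)] e by simp
qed

lemma orientation_rect:
  assumes ab: "0 < b" "b \<le> a" and \<theta>: "0 \<le> \<theta>" "\<theta> < pi" and sq: "a = b \<Longrightarrow> \<theta> < pi / 2"
  shows "orientation (rect c \<theta> a b) = \<theta>"
  unfolding orientation_def
proof (rule Least_equality)
  show "0 \<le> \<theta> \<and> \<theta> < pi \<and> (\<exists>c' a' b'. 0 < b' \<and> b' \<le> a' \<and> rect c \<theta> a b = rect c' \<theta> a' b')"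
    using ab \<theta> by blast
next
  fix \<omega>
  assume \<omega>: "0 \<le> \<omega> \<and> \<omega> < pi \<and> (\<exists>c' a' b'. 0 < b' \<and> b' \<le> a' \<and> rect c \<theta> a b = rect c' \<omega> a' b')"
  then obtain c' a' b' where r: "rect c \<theta> a b = rect c' \<omega> a' b'" "0 < b'" "b' \<le> a'" by blast
  note u = rect_unique[OF r(1) ab r(2,3)]
  show "\<theta> \<le> \<omega>"
  proof (rule ccontr)
    assume "\<not> \<theta> \<le> \<omega>"
    then have pos: "0 < \<theta> - \<omega>" "\<theta> - \<omega> < pi" using \<omega> \<theta> by auto
    then have s: "sin (\<theta> - \<omega>) > 0" by (rule sin_gt_zero)
    with u(3) sq have "\<theta> < pi / 2" by auto
    then have "cos (\<theta> - \<omega>) > 0" using pos \<omega> by (intro cos_gt_zero) auto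
    with s u(4) show False by simp
  qed
qed

end

theory Submission
  imports Defs
begin

text \<open>
  If \<open>M\<^sub>B\<close> is bounded on \<open>L\<^sup>p\<close>, then so is \<open>M\<^sub>\<Omega>\<close>, for the same \<open>p\<close>.  Let \<open>R\<close> be an \<open>a \<times> b\<close> rectangle with
  direction \<open>\<omega> \<in> \<Omega>\<close> and let \<open>x \<in> R\<close>.  Some homothet \<open>T\<close> of an element of \<open>B\<close> is centred at \<open>x\<close>, has
  direction \<open>\<omega>\<close>, length \<open>5a\<close> and width at most \<open>b\<close>.  Since \<open>\<omega>\<close> stays away from the vertical, the
  translates \<open>T + (0, t)\<close> with \<open>\<bar>t\<bar> \<le> 3b\<close> cover \<open>R\<close> evenly, so the average of \<open>\<bar>f\<bar>\<close> over \<open>R\<close> is at most a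
  constant times the average of \<open>M\<^sub>B f\<close> over the vertical segment of half-length \<open>3b\<close> centred at
  \<open>x\<close>.  Hence \<open>M\<^sub>\<Omega> f\<close> is pointwise dominated by the one-dimensional Hardy--Littlewood maximal
  function of \<open>M\<^sub>B f\<close> in the vertical direction, which is bounded on \<open>L\<^sup>p\<close> by the Vitali covering lemma,
  truncation and Fubini's theorem on each vertical line.
\<close>

section \<open>The one-dimensional Hardy--Littlewood maximal function\<close>

text \<open>Rational radii make the supremum countable, hence measurable.\<close>

lemma cball_borel [measurable]: "cball x r \<in> sets borel"
  by (rule borel_closed) simp

definition hl_max :: "(real \<Rightarrow> ennreal) \<Rightarrow> real \<Rightarrow> ennreal" where
  "hl_max g y =
     (SUP \<rho> \<in> {\<rho> \<in> \<rat>. 0 < \<rho>}. (\<integral>\<^sup>+ t \<in> {-\<rho>..\<rho>}. g (y + t) \<partial>lborel) / ennreal (2 * \<rho>))"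

lemma countable_pos_rats: "countable {\<rho> \<in> \<rat>. 0 < (\<rho>::real)}"
  by (rule countable_subset[OF _ countable_rat]) auto

lemma measurable_window_average [measurable]:
  fixes g :: "real \<Rightarrow> ennreal"
  assumes [measurable]: "g \<in> borel_measurable borel"
  shows "(\<lambda>y. (\<integral>\<^sup>+ t \<in> {-\<rho>..\<rho>}. g (y + t) \<partial>lborel) / ennreal (2 * \<rho>)) \<in> borel_measurable borel"
  by measurable

lemma borel_measurable_hl_max [measurable]:
  assumes [measurable]: "g \<in> borel_measurable borel"
  shows "hl_max g \<in> borel_measurable borel"
  unfolding hl_max_def[abs_def]
  by (intro borel_measurable_SUP countable_pos_rats) measurable

text \<open>Viewed as the mass of a ball under the measure with density \<open>g\<close>, a window
  integral becomes additive over disjoint balls, as the Vitali argument requires.\<close>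

lemma nn_integral_window:
  fixes g :: "real \<Rightarrow> ennreal"
  assumes [measurable]: "g \<in> borel_measurable borel"
  shows "(\<integral>\<^sup>+ t \<in> {-\<rho>..\<rho>}. g (y + t) \<partial>lborel) = emeasure (density lborel g) (cball y \<rho>)"
proof -
  have "emeasure (density lborel g) (cball y \<rho>) = (\<integral>\<^sup>+ x. g x * indicator (cball y \<rho>) x \<partial>lborel)"
    by (subst emeasure_density) auto
  also have "\<dots> = (\<integral>\<^sup>+ t. g (y + 1 * t) * indicator (cball y \<rho>) (y + 1 * t) \<partial>lborel)"
    by (subst nn_integral_real_affine[of _ 1 y]) auto
  also have "\<dots> = (\<integral>\<^sup>+ t \<in> {-\<rho>..\<rho>}. g (y + t) \<partial>lborel)"
    by (intro nn_integral_cong) (auto simp: indicator_def dist_real_def)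
  finally show ?thesis ..
qed

text \<open>Every point of the level set is the centre of a ball whose \<open>g\<close>-mass exceeds
  \<open>l\<close> times its length. By Vitali, a disjoint subfamily dilated by 5 still covers the
  set, and the masses of disjoint balls add up to at most the integral of \<open>g\<close>.\<close>

lemma hl_max_weak_type:
  fixes g :: "real \<Rightarrow> ennreal"
  assumes g [measurable]: "g \<in> borel_measurable borel"
  shows "ennreal l * emeasure lborel {y. ennreal l < hl_max g y} \<le> 5 * (\<integral>\<^sup>+ y. g y \<partial>lborel)"
proof -
  define D where "D = density lborel g"
  have sets_D [simp]: "sets D = sets borel" by (simp add: D_def)
  \<comment> \<open>The covering lemma asks for bounded radii, hence the cutoff at \<open>N\<close>;
    it is removed at the end by continuity of the measure along the increasing sets
    \<open>S N\<close>.\<close>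
  define S where "S N = {y. \<exists>\<rho>\<in>\<rat>. 0 < \<rho> \<and> \<rho> \<le> real N \<and> ennreal l < emeasure D (cball y \<rho>) / ennreal (2 * \<rho>)}"
    for N
  have [measurable]: "S N \<in> sets borel" for N
  proof -
    have "S N = (\<Union>\<rho>\<in>{\<rho>\<in>\<rat>. 0 < \<rho> \<and> \<rho> \<le> real N}.
        {y \<in> space borel. ennreal l < (\<integral>\<^sup>+ t \<in> {-\<rho>..\<rho>}. g (y + t) \<partial>lborel) / ennreal (2 * \<rho>)})"
      by (auto simp: S_def nn_integral_window D_def)
    also have "\<dots> \<in> sets borel"
      by (intro sets.countable_UN' countable_subset[OF _ countable_rat]) (auto, measurable)
    finally show ?thesis .
  qed
  have main: "ennreal l * emeasure lborel (S N) \<le> 5 * (\<integral>\<^sup>+ y. g y \<partial>lborel)" for N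
  proof -
    have "\<forall>y\<in>S N. \<exists>\<rho>. 0 < \<rho> \<and> \<rho> \<le> real N \<and> ennreal l < emeasure D (cball y \<rho>) / ennreal (2 * \<rho>)"
      unfolding S_def by blast
    then obtain r where r: "\<And>y. y \<in> S N \<Longrightarrow> 0 < r y \<and> r y \<le> real N \<and>
        ennreal l < emeasure D (cball y (r y)) / ennreal (2 * r y)"
      by metis
    have cov: "S N \<subseteq> (\<Union>y\<in>S N. cball y (r y))"
      using r by force
    have radii: "0 < r y \<and> r y \<le> real N" if "y \<in> S N" for y
      using r that by blast
    obtain C where C: "countable C" "C \<subseteq> S N"
      "pairwise (\<lambda>i j. disjnt (cball i (r i)) (cball j (r j))) C"
      "S N \<subseteq> (\<Union>i\<in>C. cball i (5 * r i))"
      by (rule Vitali_covering_lemma_cballs[OF cov radii])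
    have "emeasure lborel (S N) = (\<integral>\<^sup>+ x. indicator (S N) x \<partial>lborel)" by simp
    \<comment> \<open>Sums over \<open>C\<close> are written as integrals against
      \<open>count_space C\<close>, so that exchanging sum and integral is an instance of
      Tonelli.\<close>
    also have "\<dots> \<le> (\<integral>\<^sup>+ x. \<integral>\<^sup>+ i. indicator (cball i (5 * r i)) x \<partial>count_space C \<partial>lborel)"
    proof (intro nn_integral_mono)
      fix x :: real
      show "indicator (S N) x \<le> (\<integral>\<^sup>+ i. indicator (cball i (5 * r i)) x \<partial>count_space C)"
      proof (cases "x \<in> S N")
        case True
        then obtain i where i: "i \<in> C" "x \<in> cball i (5 * r i)" using C(4) by blast
        have "1 = (indicator (cball i (5 * r i)) x :: ennreal)" using i by simp
        also have "\<dots> \<le> (\<integral>\<^sup>+ i. indicator (cball i (5 * r i)) x \<partial>count_space C)"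
          by (rule nn_integral_ge_point[OF i(1)])
        finally show ?thesis using True by simp
      qed simp
    qed
    also have "\<dots> = (\<integral>\<^sup>+ i. \<integral>\<^sup>+ x. indicator (cball i (5 * r i)) x \<partial>lborel \<partial>count_space C)"
      by (rule nn_integral_count_space_nn_integral) (use C in auto)
    also have "\<dots> = (\<integral>\<^sup>+ i. ennreal (10 * r i) \<partial>count_space C)"
    proof (intro nn_integral_cong)
      fix i assume "i \<in> space (count_space C)"
      then have "0 < r i" using C r by auto
      then show "(\<integral>\<^sup>+ x. indicator (cball i (5 * r i)) x \<partial>lborel) = ennreal (10 * r i)"
        by (simp add: cball_eq_atLeastAtMost)
    qed
    finally have "ennreal l * emeasure lborel (S N) \<le> ennreal l * (\<integral>\<^sup>+ i. ennreal (10 * r i) \<partial>count_space C)"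
      by (rule mult_left_mono) simp
    also have "\<dots> = (\<integral>\<^sup>+ i. ennreal l * ennreal (10 * r i) \<partial>count_space C)"
      by (rule nn_integral_cmult[symmetric]) simp
    also have "\<dots> \<le> (\<integral>\<^sup>+ i. 5 * emeasure D (cball i (r i)) \<partial>count_space C)"
    proof (intro nn_integral_mono)
      fix i assume "i \<in> space (count_space C)"
      then have i: "0 < r i" "ennreal l < emeasure D (cball i (r i)) / ennreal (2 * r i)"
        using C r by auto
      have "ennreal l * ennreal (2 * r i) \<le> emeasure D (cball i (r i)) / ennreal (2 * r i) * ennreal (2 * r i)"
        using i(2) by (intro mult_right_mono) auto
      also have "\<dots> = emeasure D (cball i (r i))"
        using i(1) by (subst ennreal_divide_times) (simp add: ennreal_mult_divide_eq ennreal_divide_times)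
      finally have "5 * (ennreal l * ennreal (2 * r i)) \<le> 5 * emeasure D (cball i (r i))"
        by (rule mult_left_mono) simp
      moreover have "ennreal (10 * r i) = 5 * ennreal (2 * r i)"
        using i(1) by (simp add: ennreal_mult'' flip: ennreal_numeral) (simp add: ennreal_mult'[symmetric])
      ultimately show "ennreal l * ennreal (10 * r i) \<le> 5 * emeasure D (cball i (r i))"
        by (simp add: ac_simps)
    qed
    also have "\<dots> = 5 * (\<integral>\<^sup>+ i. emeasure D (cball i (r i)) \<partial>count_space C)"
      by (rule nn_integral_cmult) simp
    also have "(\<integral>\<^sup>+ i. emeasure D (cball i (r i)) \<partial>count_space C) = emeasure D (\<Union>i\<in>C. cball i (r i))"
      by (rule emeasure_UN_countable[symmetric])
         (use C in \<open>auto simp: disjoint_family_on_def pairwise_def disjnt_def\<close>)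
    also have "\<dots> \<le> emeasure D UNIV"
      using emeasure_space[of D] by (simp add: D_def)
    also have "emeasure D UNIV = (\<integral>\<^sup>+ y. g y \<partial>lborel)"
      by (simp add: D_def emeasure_density)
    finally show ?thesis by (simp add: mult_left_mono)
  qed
  have "{y. ennreal l < hl_max g y} = (\<Union>N. S N)"
  proof (intro set_eqI iffI)
    fix y assume "y \<in> {y. ennreal l < hl_max g y}"
    then obtain \<rho> where "\<rho> \<in> \<rat>" "0 < \<rho>" "ennreal l < emeasure D (cball y \<rho>) / ennreal (2 * \<rho>)"
      by (auto simp: hl_max_def less_SUP_iff nn_integral_window D_def)
    moreover obtain N where "\<rho> \<le> real N" using real_arch_simple by blast
    ultimately show "y \<in> (\<Union>N. S N)" by (auto simp: S_def)
  qed (auto simp: S_def hl_max_def less_SUP_iff nn_integral_window D_def)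
  moreover have "incseq S"
    unfolding incseq_def S_def using of_nat_mono order_trans by fast
  ultimately have "emeasure lborel {y. ennreal l < hl_max g y} = (SUP N. emeasure lborel (S N))"
    using SUP_emeasure_incseq[of S lborel] by (simp add: image_subset_iff)
  then have "ennreal l * emeasure lborel {y. ennreal l < hl_max g y} = (SUP N. ennreal l * emeasure lborel (S N))"
    by (simp add: SUP_mult_left_ennreal)
  also have "\<dots> \<le> 5 * (\<integral>\<^sup>+ y. g y \<partial>lborel)"
    by (rule SUP_least) (rule main)
  finally show ?thesis .
qed

section \<open>Powers on [0, \<infinity>], the layer-cake formula and the strong-type bound\<close>

lemma ennreal_powr_top [simp]: "ennreal_powr top p = top"
  by (simp add: ennreal_powr_def)

lemma ennreal_powr_ennreal: "0 \<le> r \<Longrightarrow> ennreal_powr (ennreal r) p = ennreal (r powr p)"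
  by (simp add: ennreal_powr_def)

lemma ennreal_powr_mono:
  assumes "x \<le> y" "0 < p"
  shows "ennreal_powr x p \<le> ennreal_powr y p"
proof (cases y)
  case (real r)
  with assms obtain s where "0 \<le> s" "x = ennreal s" by (cases x) (auto simp: top_unique)
  with real assms show ?thesis by (auto simp: ennreal_powr_ennreal intro!: ennreal_leI powr_mono2)
qed simp

lemma ennreal_powr_mult:
  assumes "0 \<le> c" "0 < p"
  shows "ennreal_powr (ennreal c * x) p = ennreal (c powr p) * ennreal_powr x p"
proof (cases x)
  case (real r)
  with assms show ?thesis
    by (simp add: ennreal_mult'[symmetric] ennreal_powr_ennreal powr_mult)
next
  case top
  with assms show ?thesis
    by (cases "c = 0") (auto simp: ennreal_mult_top ennreal_powr_ennreal[of 0, simplified])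
qed

lemma borel_measurable_ennreal_powr [measurable]:
  assumes [measurable]: "f \<in> borel_measurable M"
  shows "(\<lambda>x. ennreal_powr (f x) p) \<in> borel_measurable M"
  unfolding ennreal_powr_def by measurable

text \<open>This is the integral of \<open>l powr q\<close> from 0 to \<open>x\<close>, and
  \<open>- 1 < q\<close> makes it converge at 0. The strong-type proof uses it twice, with
  \<open>q = p - 1\<close> and with \<open>q = p - 2\<close>, which may be negative.\<close>

lemma ennreal_powr_layer_cake:
  assumes q: "- 1 < q"
  shows "ennreal (q + 1) *
           (\<integral>\<^sup>+ l. ennreal (l powr q) * indicator {l. 0 < l \<and> ennreal l < x} l \<partial>lborel) = ennreal_powr x (q + 1)"
proof -
  define J where "J = (\<lambda>x. \<integral>\<^sup>+ l. ennreal (l powr q) * indicator {l. 0 < l \<and> ennreal l < x} l \<partial>lborel)"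
  have fin: "ennreal (q + 1) * J (ennreal r) = ennreal (r powr (q + 1))" if r: "0 \<le> r" for r
  proof -
    have "J (ennreal r) = (\<integral>\<^sup>+ l. ennreal (l powr q * indicator {0..r} l) \<partial>lborel)"
      unfolding J_def
    proof (rule nn_integral_cong_AE)
      \<comment> \<open>The open and the closed interval differ only at their end points, a null
        set.\<close>
      have "AE l in lborel. l \<noteq> 0 \<and> l \<noteq> r"
        using AE_lborel_singleton[of 0] AE_lborel_singleton[of r] by eventually_elim auto
      then show "AE l in lborel. ennreal (l powr q) * indicator {l. 0 < l \<and> ennreal l < ennreal r} l
          = ennreal (l powr q * indicator {0..r} l)"
        by eventually_elim (auto simp: indicator_def ennreal_less_iff)
    qed
    also have "\<dots> = ennreal (r powr (q + 1) / (q + 1))"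
    proof (rule nn_integral_has_integral_lborel)
      have "((\<lambda>l. if l \<in> {0..r} then l powr q else 0) has_integral r powr (q + 1) / (q + 1)) UNIV"
        using has_integral_powr_from_0[OF q r] by (subst has_integral_restrict_UNIV)
      then show "((\<lambda>l. l powr q * indicator {0..r} l) has_integral r powr (q + 1) / (q + 1)) UNIV"
        by (rule has_integral_eq[rotated]) (auto simp: indicator_def)
    qed (auto simp: indicator_def)
    finally show ?thesis using q by (simp add: ennreal_mult'[symmetric])
  qed
  have "ennreal (q + 1) * J x = ennreal_powr x (q + 1)"
  proof (cases x)
    case (real r)
    then show ?thesis using fin by (simp add: ennreal_powr_ennreal)
  next
    case top
    \<comment> \<open>For infinite \<open>x\<close> the integral dominates every finite case, and
      \<open>r\<close> is chosen so that the finite case has the arbitrary value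
      \<open>R\<close>.\<close>
    have ge: "ennreal R \<le> ennreal (q + 1) * J top" if "0 < R" for R
    proof -
      define r where "r = R powr (1 / (q + 1))"
      have "r powr (q + 1) = R" using that q by (simp add: r_def powr_powr)
      then have "ennreal R = ennreal (q + 1) * J (ennreal r)" by (subst fin) (auto simp: r_def)
      also have "\<dots> \<le> ennreal (q + 1) * J top"
        unfolding J_def by (intro mult_left_mono nn_integral_mono) (auto simp: indicator_def)
      finally show ?thesis .
    qed
    have "ennreal (q + 1) * J top = top"
    proof (rule ccontr)
      assume "ennreal (q + 1) * J top \<noteq> top"
      then obtain s where "0 \<le> s" "ennreal (q + 1) * J top = ennreal s"
        by (cases "ennreal (q + 1) * J top") auto
      with ge[of "s + 1"] show False by (simp add: ennreal_le_iff)
    qed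
    with top show ?thesis by simp
  qed
  then show ?thesis by (simp add: J_def)
qed

text \<open>After Fubini the inner integral in the strong-type proof produces a power of
  \<open>2 * g y\<close>, still multiplied by \<open>g y\<close>. Covering \<infinity> as well
  spares a separate treatment of the points where \<open>g\<close> is infinite.\<close>

lemma mult_ennreal_powr_double:
  assumes "1 < p"
  shows "x * ennreal_powr (2 * x) (p - 1) = ennreal (2 powr (p - 1)) * ennreal_powr x p"
proof (cases x)
  case (real r)
  have "r * (2 * r) powr (p - 1) = 2 powr (p - 1) * r powr p"
    using real(1) by (cases "r = 0") (auto simp: powr_mult powr_diff)
  moreover have "2 * ennreal r = ennreal (2 * r)" using real by (simp add: ennreal_mult')
  ultimately show ?thesis
    using real by (simp add: ennreal_powr_ennreal ennreal_mult'[symmetric] del: ennreal_mult')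
next
  case top
  then show ?thesis by (simp add: ennreal_mult_top)
qed

text \<open>Only the part of \<open>g\<close> above height \<open>l / 2\<close> matters for the level set at height \<open>l\<close>.\<close>

lemma hl_max_weak_type_truncated:
  fixes g :: "real \<Rightarrow> ennreal"
  assumes g [measurable]: "g \<in> borel_measurable borel" and l: "0 < l"
  shows "ennreal l * emeasure lborel {y. ennreal l < hl_max g y}
           \<le> 10 * (\<integral>\<^sup>+ y. g y * indicator {y. ennreal l < 2 * g y} y \<partial>lborel)"
proof -
  define G where "G = (\<lambda>y. g y * indicator {y. ennreal l < 2 * g y} y)"
  have G [measurable]: "G \<in> borel_measurable borel" by (simp add: G_def)
  have half: "ennreal l = 2 * ennreal (l / 2)"
    using l by (metis ennreal_mult' ennreal_numeral field_sum_of_halves mult_2 zero_le_numeral)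
  \<comment> \<open>Where the truncation removes \<open>g\<close>, its value is at most
    \<open>l / 2\<close>, and a constant averages to itself. Hence the level set of \<open>g\<close>
    at \<open>l\<close> lies in that of \<open>G\<close> at \<open>l / 2\<close>; halving the level
    turns the weak-type constant 5 into 10.\<close>
  have gG: "g y \<le> G y + ennreal (l / 2)" for y
  proof (cases "ennreal l < 2 * g y")
    case False
    then have "2 * g y \<le> 2 * ennreal (l / 2)" by (simp add: half)
    then show ?thesis using ennreal_mult_le_mult_iff[of 2] by (simp add: add_increasing)
  qed (simp add: G_def)
  have "hl_max g y \<le> hl_max G y + ennreal (l / 2)" for y
    unfolding hl_max_def
  proof (rule SUP_least)
    fix \<rho> :: real assume \<rho>: "\<rho> \<in> {\<rho> \<in> \<rat>. 0 < \<rho>}"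
    have "(\<integral>\<^sup>+ t \<in> {-\<rho>..\<rho>}. g (y + t) \<partial>lborel)
        \<le> (\<integral>\<^sup>+ t. G (y + t) * indicator {-\<rho>..\<rho>} t + ennreal (l / 2) * indicator {-\<rho>..\<rho>} t \<partial>lborel)"
      by (intro nn_integral_mono) (auto simp: indicator_def gG)
    also have "\<dots> = (\<integral>\<^sup>+ t \<in> {-\<rho>..\<rho>}. G (y + t) \<partial>lborel) + ennreal (l / 2) * ennreal (2 * \<rho>)"
      using \<rho> by (subst nn_integral_add) (auto simp: nn_integral_cmult_indicator)
    finally have "(\<integral>\<^sup>+ t \<in> {-\<rho>..\<rho>}. g (y + t) \<partial>lborel) / ennreal (2 * \<rho>)
        \<le> ((\<integral>\<^sup>+ t \<in> {-\<rho>..\<rho>}. G (y + t) \<partial>lborel) + ennreal (l / 2) * ennreal (2 * \<rho>)) / ennreal (2 * \<rho>)"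
      by (rule divide_right_mono_ennreal)
    also have "\<dots> = (\<integral>\<^sup>+ t \<in> {-\<rho>..\<rho>}. G (y + t) \<partial>lborel) / ennreal (2 * \<rho>) + ennreal (l / 2)"
      using \<rho> by (simp add: add_divide_distrib_ennreal ennreal_mult_divide_eq)
    also have "\<dots> \<le> (SUP \<rho> \<in> {\<rho> \<in> \<rat>. 0 < \<rho>}. (\<integral>\<^sup>+ t \<in> {-\<rho>..\<rho>}. G (y + t) \<partial>lborel) / ennreal (2 * \<rho>)) + ennreal (l / 2)"
      using \<rho> by (intro add_right_mono SUP_upper)
    finally show "(\<integral>\<^sup>+ t \<in> {-\<rho>..\<rho>}. g (y + t) \<partial>lborel) / ennreal (2 * \<rho>) \<le> \<dots>" .
  qed
  then have "ennreal (l / 2) < hl_max G y" if "ennreal l < hl_max g y" for y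
  proof -
    have "ennreal (l / 2) + ennreal (l / 2) < hl_max G y + ennreal (l / 2)"
      using less_le_trans[OF that \<open>hl_max g y \<le> _\<close>] l by (simp add: ennreal_plus[symmetric] del: ennreal_plus)
    then show ?thesis by (metis add_right_mono not_le)
  qed
  then have "emeasure lborel {y. ennreal l < hl_max g y} \<le> emeasure lborel {y. ennreal (l / 2) < hl_max G y}"
    by (intro emeasure_mono) auto
  then have "ennreal l * emeasure lborel {y. ennreal l < hl_max g y}
      \<le> 2 * (ennreal (l / 2) * emeasure lborel {y. ennreal (l / 2) < hl_max G y})"
    unfolding half by (simp add: mult.assoc mult_left_mono)
  also have "\<dots> \<le> 2 * (5 * (\<integral>\<^sup>+ y. G y \<partial>lborel))"
    by (intro mult_left_mono hl_max_weak_type) auto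
  finally show ?thesis by (simp add: G_def mult.assoc[symmetric])
qed

text \<open>Marcinkiewicz interpolation: layer cake for \<open>hl_max g\<close>, the truncated
  weak-type bound at each level, Fubini, then layer cake for \<open>2 * g y\<close>. The factor
  \<open>p\<close> comes from the first layer cake, 10 from the truncation, and
  \<open>2 powr (p - 1) / (p - 1)\<close> from the second layer cake.\<close>

lemma hl_max_strong_type:
  fixes g :: "real \<Rightarrow> ennreal"
  assumes g [measurable]: "g \<in> borel_measurable borel" and p: "1 < p"
  shows "(\<integral>\<^sup>+ y. ennreal_powr (hl_max g y) p \<partial>lborel)
           \<le> ennreal (10 * p / (p - 1) * 2 powr (p - 1)) * (\<integral>\<^sup>+ y. ennreal_powr (g y) p \<partial>lborel)"
proof -
  \<comment> \<open>The weight absorbs the condition \<open>0 < l\<close>. What remains is a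
    level-set indicator that can be read as a function of \<open>l\<close> or of \<open>y\<close>,
    as Fubini demands.\<close>
  define c where "c q l = ennreal (l powr q) * indicator {0<..} l" for q l :: real
  have c_meas [measurable]: "c q \<in> borel_measurable borel" for q unfolding c_def by measurable
  have split: "ennreal (l powr q) * indicator {l. 0 < l \<and> ennreal l < x} l = c q l * indicator {l. ennreal l < x} l"
    for q l x by (simp add: c_def indicator_def)
  note layer = ennreal_powr_layer_cake[unfolded split]
  have "(\<integral>\<^sup>+ y. ennreal_powr (hl_max g y) p \<partial>lborel)
      = (\<integral>\<^sup>+ y. ennreal p * (\<integral>\<^sup>+ l. c (p - 1) l * indicator {l. ennreal l < hl_max g y} l \<partial>lborel) \<partial>lborel)"
    using layer[of "p - 1"] p by simp
  also have "\<dots> = ennreal p * (\<integral>\<^sup>+ y. \<integral>\<^sup>+ l. c (p - 1) l * indicator {l. ennreal l < hl_max g y} l \<partial>lborel \<partial>lborel)"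
    by (rule nn_integral_cmult) measurable
  also have "(\<integral>\<^sup>+ y. \<integral>\<^sup>+ l. c (p - 1) l * indicator {l. ennreal l < hl_max g y} l \<partial>lborel \<partial>lborel)
      = (\<integral>\<^sup>+ l. \<integral>\<^sup>+ y. c (p - 1) l * indicator {l. ennreal l < hl_max g y} l \<partial>lborel \<partial>lborel)"
    by (rule lborel_pair.Fubini') measurable
  also have "\<dots> \<le> (\<integral>\<^sup>+ l. 10 * (\<integral>\<^sup>+ y. c (p - 2) l * (g y * indicator {l. ennreal l < 2 * g y} l) \<partial>lborel) \<partial>lborel)"
  proof (intro nn_integral_mono)
    fix l :: real
    show "(\<integral>\<^sup>+ y. c (p - 1) l * indicator {l. ennreal l < hl_max g y} l \<partial>lborel)
        \<le> 10 * (\<integral>\<^sup>+ y. c (p - 2) l * (g y * indicator {l. ennreal l < 2 * g y} l) \<partial>lborel)"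
    proof (cases "0 < l")
      case True
      \<comment> \<open>One factor \<open>l\<close> is split off for the weak-type estimate to
        absorb. The remaining exponent \<open>p - 2\<close> exceeds -1 because
        \<open>1 < p\<close>.\<close>
      have cc: "c (p - 1) l = c (p - 2) l * ennreal l"
      proof -
        have "l powr (p - 1) = l powr (p - 2) * l powr 1"
          unfolding powr_add[symmetric] by simp
        then show ?thesis using True by (simp add: c_def ennreal_mult'')
      qed
      have "(\<integral>\<^sup>+ y. c (p - 1) l * indicator {l. ennreal l < hl_max g y} l \<partial>lborel)
          = (\<integral>\<^sup>+ y. c (p - 1) l * indicator {y. ennreal l < hl_max g y} y \<partial>lborel)"
        by (intro nn_integral_cong) (simp add: indicator_def)
      also have "\<dots> = c (p - 1) l * emeasure lborel {y. ennreal l < hl_max g y}"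
        by (rule nn_integral_cmult_indicator) simp
      also have "\<dots> = c (p - 2) l * (ennreal l * emeasure lborel {y. ennreal l < hl_max g y})"
        by (simp add: cc mult.assoc)
      also have "\<dots> \<le> c (p - 2) l * (10 * (\<integral>\<^sup>+ y. g y * indicator {y. ennreal l < 2 * g y} y \<partial>lborel))"
        by (intro mult_left_mono hl_max_weak_type_truncated True g) simp
      also have "\<dots> = 10 * (\<integral>\<^sup>+ y. c (p - 2) l * (g y * indicator {y. ennreal l < 2 * g y} y) \<partial>lborel)"
        by (subst nn_integral_cmult) (auto simp: ac_simps)
      also have "(\<integral>\<^sup>+ y. c (p - 2) l * (g y * indicator {y. ennreal l < 2 * g y} y) \<partial>lborel)
          = (\<integral>\<^sup>+ y. c (p - 2) l * (g y * indicator {l. ennreal l < 2 * g y} l) \<partial>lborel)"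
        by (intro nn_integral_cong) (simp add: indicator_def)
      finally show ?thesis .
    qed (simp add: c_def)
  qed
  also have "\<dots> = 10 * (\<integral>\<^sup>+ l. \<integral>\<^sup>+ y. c (p - 2) l * (g y * indicator {l. ennreal l < 2 * g y} l) \<partial>lborel \<partial>lborel)"
    by (rule nn_integral_cmult) measurable
  also have "(\<integral>\<^sup>+ l. \<integral>\<^sup>+ y. c (p - 2) l * (g y * indicator {l. ennreal l < 2 * g y} l) \<partial>lborel \<partial>lborel)
      = (\<integral>\<^sup>+ y. \<integral>\<^sup>+ l. c (p - 2) l * (g y * indicator {l. ennreal l < 2 * g y} l) \<partial>lborel \<partial>lborel)"
    by (rule lborel_pair.Fubini'[symmetric]) measurable
  also have "\<dots> = (\<integral>\<^sup>+ y. g y * (\<integral>\<^sup>+ l. c (p - 2) l * indicator {l. ennreal l < 2 * g y} l \<partial>lborel) \<partial>lborel)"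
    by (intro nn_integral_cong) (subst nn_integral_cmult[symmetric], auto simp: ac_simps)
  also have "\<dots> = (\<integral>\<^sup>+ y. ennreal (2 powr (p - 1) / (p - 1)) * ennreal_powr (g y) p \<partial>lborel)"
  proof (intro nn_integral_cong)
    fix y
    define I where "I = (\<integral>\<^sup>+ l. c (p - 2) l * indicator {l. ennreal l < 2 * g y} l \<partial>lborel)"
    have "ennreal (p - 1) * I = ennreal_powr (2 * g y) (p - 1)"
      using layer[of "p - 2" "2 * g y"] p by (simp add: I_def)
    then have "I = ennreal (1 / (p - 1)) * ennreal_powr (2 * g y) (p - 1)"
      using p by (metis (no_types, lifting) I_def diff_gt_0_iff_gt divide_nonneg_pos ennreal_1 ennreal_mult'' less_eq_real_def mult.assoc mult_1 nonzero_eq_divide_eq order_less_irrefl zero_le_one)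
    then have "g y * I = ennreal (1 / (p - 1)) * (g y * ennreal_powr (2 * g y) (p - 1))"
      by (simp add: ac_simps)
    also have "\<dots> = ennreal (2 powr (p - 1) / (p - 1)) * ennreal_powr (g y) p"
      unfolding mult_ennreal_powr_double[OF p] using p by (simp add: mult.assoc[symmetric] ennreal_mult'[symmetric])
    finally show "g y * I = ennreal (2 powr (p - 1) / (p - 1)) * ennreal_powr (g y) p" .
  qed
  also have "\<dots> = ennreal (2 powr (p - 1) / (p - 1)) * (\<integral>\<^sup>+ y. ennreal_powr (g y) p \<partial>lborel)"
    by (rule nn_integral_cmult) measurable
  also have "ennreal p * (10 * (ennreal (2 powr (p - 1) / (p - 1)) * (\<integral>\<^sup>+ y. ennreal_powr (g y) p \<partial>lborel)))
      = ennreal (10 * p / (p - 1) * 2 powr (p - 1)) * (\<integral>\<^sup>+ y. ennreal_powr (g y) p \<partial>lborel)"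
  proof -
    have "ennreal p * (10 * ennreal (2 powr (p - 1) / (p - 1))) = ennreal (10 * p / (p - 1) * 2 powr (p - 1))"
      using p by (simp add: ennreal_mult'[symmetric] flip: ennreal_numeral)
    then show ?thesis by (simp add: mult.assoc[symmetric])
  qed
  finally show ?thesis
    by (simp add: mult_left_mono)
qed

section \<open>Rectangles and their area\<close>

lemma dir_perp: "dir (\<theta> + pi / 2) = (- sin \<theta>, cos \<theta>)"
  by (simp add: dir_def cos_add sin_add)

lemma dir_frame: "(x \<bullet> dir \<theta>) *\<^sub>R dir \<theta> + (x \<bullet> dir (\<theta> + pi / 2)) *\<^sub>R dir (\<theta> + pi / 2) = x"
proof (cases x)
  case (Pair p q)
  have 1: "p * cos \<theta> * cos \<theta> + p * sin \<theta> * sin \<theta> = p"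
    by (metis distrib_left mult.assoc mult.right_neutral power2_eq_square sin_cos_squared_add2)
  have 2: "q * cos \<theta> * cos \<theta> + q * sin \<theta> * sin \<theta> = q"
    by (metis distrib_left mult.assoc mult.right_neutral power2_eq_square sin_cos_squared_add2)
  show ?thesis using 1 2 unfolding Pair
    by (simp add: dir_def cos_add sin_add algebra_simps)
qed

lemma mem_rect_iff:
  "x \<in> rect c \<theta> a b \<longleftrightarrow> (x - c) \<bullet> dir \<theta> \<in> {0..a} \<and> (x - c) \<bullet> dir (\<theta> + pi / 2) \<in> {0..b}"
proof
  assume "x \<in> rect c \<theta> a b"
  then show "(x - c) \<bullet> dir \<theta> \<in> {0..a} \<and> (x - c) \<bullet> dir (\<theta> + pi / 2) \<in> {0..b}"
    by (auto simp: rect_def inner_add_left inner_dir)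
next
  assume "(x - c) \<bullet> dir \<theta> \<in> {0..a} \<and> (x - c) \<bullet> dir (\<theta> + pi / 2) \<in> {0..b}"
  moreover have "x = c + ((x - c) \<bullet> dir \<theta>) *\<^sub>R dir \<theta> + ((x - c) \<bullet> dir (\<theta> + pi / 2)) *\<^sub>R dir (\<theta> + pi / 2)"
    using dir_frame[of "x - c" \<theta>] by (simp add: algebra_simps)
  ultimately show "x \<in> rect c \<theta> a b" unfolding rect_def by (auto simp: mem_Collect_eq)
qed

lemma closed_rect: "closed (rect c \<theta> a b)"
proof -
  have "rect c \<theta> a b = (\<lambda>x. (x - c) \<bullet> dir \<theta>) -` {0..a} \<inter> (\<lambda>x. (x - c) \<bullet> dir (\<theta> + pi / 2)) -` {0..b}"
    by (auto simp: mem_rect_iff)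
  then show ?thesis
    by (auto intro!: closed_Int closed_vimage continuous_intros)
qed

lemma rect_borel [measurable]: "rect c \<theta> a b \<in> sets borel"
  by (rule borel_closed[OF closed_rect])

text \<open>Meant for squares: \<open>orientation\<close> selects the angle in [0, pi / 2), so a
  square presented with a larger angle has to be rewritten with the angle lowered by pi / 2.\<close>

lemma rect_swap_sides: "rect c \<theta> a b = rect (c - b *\<^sub>R dir (\<theta> - pi / 2)) (\<theta> - pi / 2) b a"
proof (intro set_eqI)
  fix x
  have "dir (\<theta> + pi / 2) = - dir (\<theta> - pi / 2)"
    by (simp add: dir_def cos_add sin_add cos_diff sin_diff)
  moreover have "dir (\<theta> - pi / 2) \<bullet> dir \<theta> = 0" "dir (\<theta> - pi / 2) \<bullet> dir (\<theta> - pi / 2) = 1"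
    by (simp_all add: inner_dir)
  ultimately show "x \<in> rect c \<theta> a b \<longleftrightarrow> x \<in> rect (c - b *\<^sub>R dir (\<theta> - pi / 2)) (\<theta> - pi / 2) b a"
    by (auto simp: mem_rect_iff inner_diff_left inner_add_left)
qed

lemma rectangle_as_rect:
  assumes "r \<in> rectangles"
  obtains c a b where "0 < b" "b \<le> a" "r = rect c (orientation r) a b"
proof -
  from assms obtain c \<theta> a b where r: "r = rect c \<theta> a b" "0 \<le> \<theta>" "\<theta> < pi" "0 < b" "b \<le> a"
    by (auto simp: rectangles_def)
  show ?thesis
  proof (cases "a = b \<and> pi / 2 \<le> \<theta>")
    case True
    then have r': "r = rect (c - b *\<^sub>R dir (\<theta> - pi / 2)) (\<theta> - pi / 2) b b"
      using r(1) rect_swap_sides by simp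
    have "orientation r = \<theta> - pi / 2"
      unfolding r' by (rule orientation_rect) (use True r in auto)
    with r' that[OF r(4) order_refl] show ?thesis by simp
  next
    case False
    have "orientation r = \<theta>"
      unfolding r(1) by (rule orientation_rect) (use False r in auto)
    with r that show ?thesis by auto
  qed
qed

lemma homothety_rect:
  assumes "0 < h"
  shows "(\<lambda>x. t + h *\<^sub>R x) ` rect c \<theta> a b = rect (t + h *\<^sub>R c) \<theta> (h * a) (h * b)"
proof (intro set_eqI iffI)
  fix x assume "x \<in> rect (t + h *\<^sub>R c) \<theta> (h * a) (h * b)"
  moreover define y where "y = (1 / h) *\<^sub>R (x - t)"
  then have x: "x = t + h *\<^sub>R y" using assms by simp
  then have "x - (t + h *\<^sub>R c) = h *\<^sub>R (y - c)" by (simp add: algebra_simps)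
  ultimately have "y \<in> rect c \<theta> a b" using assms by (auto simp: mem_rect_iff zero_le_mult_iff)
  with x show "x \<in> (\<lambda>x. t + h *\<^sub>R x) ` rect c \<theta> a b" by blast
next
  fix x assume "x \<in> (\<lambda>x. t + h *\<^sub>R x) ` rect c \<theta> a b"
  then obtain y where y: "x = t + h *\<^sub>R y" "y \<in> rect c \<theta> a b" by blast
  then have "x - (t + h *\<^sub>R c) = h *\<^sub>R (y - c)" by (simp add: algebra_simps)
  with y assms show "x \<in> rect (t + h *\<^sub>R c) \<theta> (h * a) (h * b)" by (auto simp: mem_rect_iff)
qed

text \<open>Rotation invariance of area, reduced to Tonelli and one-dimensional affine
  substitutions. The intermediate coordinates are the abscissa \<open>X\<close> and the offset
  \<open>q\<close>. Passing from \<open>X\<close> to \<open>s\<close> at fixed \<open>q\<close>, and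
  from \<open>q\<close> to \<open>Y\<close> at fixed \<open>X\<close>, gives the same factor
  \<open>cos \<theta>\<close> on both sides, which cancels because it is positive.\<close>

lemma nn_integral_dir_frame:
  fixes G :: "plane \<Rightarrow> ennreal"
  assumes G [measurable]: "G \<in> borel_measurable borel" and pos: "0 < cos \<theta>"
  shows "(\<integral>\<^sup>+ x. G x \<partial>lborel)
           = (\<integral>\<^sup>+ q. \<integral>\<^sup>+ s. G (c + s *\<^sub>R dir \<theta> + q *\<^sub>R dir (\<theta> + pi / 2)) \<partial>lborel \<partial>lborel)"
proof -
  obtain c1 c2 where c: "c = (c1, c2)" by (cases c)
  have [measurable]: "G \<in> borel_measurable (borel \<Otimes>\<^sub>M borel)" using G by (simp add: borel_prod)
  define C S where "C = cos \<theta>" and "S = sin \<theta>"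
  have C: "0 < C" "C \<noteq> 0" using pos by (auto simp: C_def)
  have CS: "C * C + S * S = 1" unfolding C_def S_def by (metis power2_eq_square sin_cos_squared_add2)
  define H where "H q X = G (X, c2 + q * C + (X - c1 + q * S) / C * S)" for q X
  have H_meas [measurable]: "(\<lambda>(q, X). H q X) \<in> borel_measurable (borel \<Otimes>\<^sub>M borel)"
    unfolding H_def by measurable
  have X: "(\<integral>\<^sup>+ X. H q X \<partial>lborel)
      = ennreal C * (\<integral>\<^sup>+ s. G (c + s *\<^sub>R dir \<theta> + q *\<^sub>R dir (\<theta> + pi / 2)) \<partial>lborel)" for q
  proof -
    have "(\<integral>\<^sup>+ X. H q X \<partial>lborel) = ennreal \<bar>C\<bar> * (\<integral>\<^sup>+ s. H q (c1 - q * S + C * s) \<partial>lborel)"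
      by (rule nn_integral_real_affine) (use C in auto)
    also have "(\<lambda>s. H q (c1 - q * S + C * s)) = (\<lambda>s. G (c + s *\<^sub>R dir \<theta> + q *\<^sub>R dir (\<theta> + pi / 2)))"
      using C by (simp add: fun_eq_iff H_def c dir_def cos_add sin_add C_def[symmetric] S_def[symmetric] algebra_simps)
    finally show ?thesis using C by simp
  qed
  have Y: "(\<integral>\<^sup>+ q. H q X \<partial>lborel) = ennreal C * (\<integral>\<^sup>+ Y. G (X, Y) \<partial>lborel)" for X
  proof -
    have 1: "c2 + q * C + (X - c1 + q * S) / C * S = (c2 + (X - c1) / C * S) + (1 / C) * q" for q
    proof -
      have "q * C + q * S / C * S = q * (C * C + S * S) / C" using C by (simp add: field_simps)
      then have "q * C + q * S / C * S = (1 / C) * q" by (simp add: CS)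
      moreover have "(X - c1 + q * S) / C * S = (X - c1) / C * S + q * S / C * S"
        by (simp add: add_divide_distrib distrib_right)
      ultimately show ?thesis by simp
    qed
    have "(\<integral>\<^sup>+ Y. G (X, Y) \<partial>lborel) = ennreal \<bar>1 / C\<bar> * (\<integral>\<^sup>+ q. G (X, (c2 + (X - c1) / C * S) + (1 / C) * q) \<partial>lborel)"
      by (rule nn_integral_real_affine) (use C in auto)
    also have "\<dots> = ennreal (1 / C) * (\<integral>\<^sup>+ q. H q X \<partial>lborel)"
      unfolding H_def 1 using C by simp
    finally have "ennreal C * (\<integral>\<^sup>+ Y. G (X, Y) \<partial>lborel) = ennreal C * ennreal (1 / C) * (\<integral>\<^sup>+ q. H q X \<partial>lborel)"
      by (simp add: mult.assoc)
    also have "ennreal C * ennreal (1 / C) = 1" using C by (simp add: ennreal_mult'[symmetric])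
    finally show ?thesis by simp
  qed
  have Gm: "G \<in> borel_measurable (lborel \<Otimes>\<^sub>M lborel)" by measurable
  have "ennreal C * (\<integral>\<^sup>+ x. G x \<partial>lborel) = ennreal C * (\<integral>\<^sup>+ X. \<integral>\<^sup>+ Y. G (X, Y) \<partial>lborel \<partial>lborel)"
    using lborel.nn_integral_fst[OF Gm] by (simp add: lborel_prod)
  also have "\<dots> = (\<integral>\<^sup>+ X. ennreal C * (\<integral>\<^sup>+ Y. G (X, Y) \<partial>lborel) \<partial>lborel)"
    by (rule nn_integral_cmult[symmetric]) measurable
  also have "\<dots> = (\<integral>\<^sup>+ q. \<integral>\<^sup>+ X. H q X \<partial>lborel \<partial>lborel)"
    unfolding Y[symmetric] by (rule lborel_pair.Fubini') measurable
  also have "\<dots> = ennreal C * (\<integral>\<^sup>+ q. \<integral>\<^sup>+ s. G (c + s *\<^sub>R dir \<theta> + q *\<^sub>R dir (\<theta> + pi / 2)) \<partial>lborel \<partial>lborel)"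
    unfolding X by (rule nn_integral_cmult) (simp add: c dir_def cos_add sin_add, measurable)
  finally show ?thesis using C by (simp add: ennreal_mult_cancel_left)
qed

lemma emeasure_rect:
  assumes "0 < cos \<theta>" "0 \<le> a" "0 \<le> b"
  shows "emeasure lborel (rect c \<theta> a b) = ennreal (a * b)"
proof -
  have "emeasure lborel (rect c \<theta> a b) = (\<integral>\<^sup>+ x. indicator (rect c \<theta> a b) x \<partial>lborel)" by simp
  also have "\<dots> = (\<integral>\<^sup>+ q. \<integral>\<^sup>+ s. indicator (rect c \<theta> a b) (c + s *\<^sub>R dir \<theta> + q *\<^sub>R dir (\<theta> + pi / 2)) \<partial>lborel \<partial>lborel)"
    by (rule nn_integral_dir_frame) (use assms in auto)
  also have "\<dots> = (\<integral>\<^sup>+ q. ennreal a * indicator {0..b} q \<partial>lborel)"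
  proof (intro nn_integral_cong)
    fix q :: real
    have "(\<integral>\<^sup>+ s. indicator (rect c \<theta> a b) (c + s *\<^sub>R dir \<theta> + q *\<^sub>R dir (\<theta> + pi / 2)) \<partial>lborel)
        = (\<integral>\<^sup>+ s. indicator {0..b} q * indicator {0..a} s \<partial>lborel)"
      by (intro nn_integral_cong) (auto simp: mem_rect_iff inner_add_left inner_dir indicator_def)
    also have "\<dots> = ennreal a * indicator {0..b} q"
      using assms by (subst nn_integral_cmult) (auto simp: mult.commute)
    finally show "(\<integral>\<^sup>+ s. indicator (rect c \<theta> a b) (c + s *\<^sub>R dir \<theta> + q *\<^sub>R dir (\<theta> + pi / 2)) \<partial>lborel) = \<dots>" .
  qed
  also have "\<dots> = ennreal (a * b)"
    using assms by (subst nn_integral_cmult) (auto simp: ennreal_mult')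
  finally show ?thesis .
qed

section \<open>Centred rectangles and the sweeping estimate\<close>

definition centered_rect :: "plane \<Rightarrow> real \<Rightarrow> real \<Rightarrow> real \<Rightarrow> plane set" where
  "centered_rect z \<theta> a b = rect (z - (a / 2) *\<^sub>R dir \<theta> - (b / 2) *\<^sub>R dir (\<theta> + pi / 2)) \<theta> a b"

lemma mem_centered_rect_iff:
  "x \<in> centered_rect z \<theta> a b \<longleftrightarrow> \<bar>(x - z) \<bullet> dir \<theta>\<bar> \<le> a / 2 \<and> \<bar>(x - z) \<bullet> dir (\<theta> + pi / 2)\<bar> \<le> b / 2"
proof -
  let ?c = "z - (a / 2) *\<^sub>R dir \<theta> - (b / 2) *\<^sub>R dir (\<theta> + pi / 2)"
  have "(x - ?c) \<bullet> dir \<theta> = (x - z) \<bullet> dir \<theta> + a / 2"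
    "(x - ?c) \<bullet> dir (\<theta> + pi / 2) = (x - z) \<bullet> dir (\<theta> + pi / 2) + b / 2"
    by (simp_all add: inner_diff_left inner_dir)
  then show ?thesis
    unfolding centered_rect_def mem_rect_iff atLeastAtMost_iff by (auto simp: abs_if split: if_splits)
qed

text \<open>This makes a centred rectangle a competitor at \<open>z\<close> in
  \<open>interior_maximal\<close>, which asks for interior points.\<close>

lemma center_in_interior:
  assumes "0 < a" "0 < b"
  shows "z \<in> interior (centered_rect z \<theta> a b)"
proof (rule interiorI)
  let ?U = "{x. \<bar>(x - z) \<bullet> dir \<theta>\<bar> < a / 2} \<inter> {x. \<bar>(x - z) \<bullet> dir (\<theta> + pi / 2)\<bar> < b / 2}"
  show "open ?U" by (intro open_Int open_Collect_less continuous_intros)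
  show "z \<in> ?U" using assms by simp
  show "?U \<subseteq> centered_rect z \<theta> a b" by (auto simp: mem_centered_rect_iff)
qed

text \<open>A fat rectangle is swept out by vertical translates of a thin one with the same direction.\<close>

lemma nn_integral_rect_le_thin_translates:
  fixes F :: "plane \<Rightarrow> ennreal"
  assumes F [measurable]: "F \<in> borel_measurable borel"
    and \<theta>: "0 \<le> \<theta>" "\<theta> \<le> pi / 4" and d: "0 < d" "d \<le> b" "b \<le> a"
    and x: "x \<in> rect c \<theta> a b"
  shows "ennreal d * (\<integral>\<^sup>+ y \<in> rect c \<theta> a b. F y \<partial>lborel)
           \<le> (\<integral>\<^sup>+ t \<in> {- (3 * b)..3 * b}. (\<integral>\<^sup>+ y \<in> centered_rect (x + (0, t)) \<theta> (5 * a) d. F y \<partial>lborel) \<partial>lborel)"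
proof -
  define C S where "C = cos \<theta>" and "S = sin \<theta>"
  define T where "T t = centered_rect (x + (0, t)) \<theta> (5 * a) d" for t
  \<comment> \<open>The incidence set to which Fubini is applied: fixing \<open>t\<close> gives a
    thin translate, fixing \<open>y\<close> gives the set of translates through \<open>y\<close>.
    Its closedness supplies joint measurability.\<close>
  define Z where "Z = {(t, y). t \<in> {- (3 * b)..3 * b} \<and> y \<in> T t}"
  have memT: "y \<in> T t \<longleftrightarrow> \<bar>(y - x) \<bullet> dir \<theta> - t * S\<bar> \<le> 5 * a / 2 \<and> \<bar>(y - x) \<bullet> dir (\<theta> + pi / 2) - t * C\<bar> \<le> d / 2"
    for y t
  proof -
    have "(0, t) \<bullet> dir \<theta> = t * S" "(0, t) \<bullet> dir (\<theta> + pi / 2) = t * C"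
      by (simp_all add: dir_perp, simp_all add: dir_def S_def C_def)
    then show ?thesis
      by (simp add: T_def mem_centered_rect_iff diff_diff_eq[symmetric] inner_diff_left[of "y - x"])
  qed
  \<comment> \<open>The bound on the direction enters here. \<open>1 / 2 \<le> C\<close> limits the
    vertical shifts to \<open>3 * b\<close>, and \<open>S \<le> C\<close> limits the displacement
    \<open>t * S\<close> along the long side to \<open>3 / 2 * a\<close>.\<close>
  have C: "1 / 2 \<le> C" "0 \<le> S" "S \<le> C" "C \<le> 1"
  proof -
    have "cos (pi / 4) \<le> C" unfolding C_def using \<theta> pi_gt_zero by (intro cos_monotone_0_pi_le) auto
    moreover have "(1::real) \<le> sqrt 2" by simp
    ultimately show "1 / 2 \<le> C" unfolding cos_45 by linarith
    show "0 \<le> S" unfolding S_def using \<theta> pi_gt_zero by (intro sin_ge_zero) auto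
    have "S \<le> sin (pi / 4)" unfolding S_def using \<theta> pi_gt_zero by (intro sin_monotone_2pi_le) auto
    with \<open>cos (pi / 4) \<le> C\<close> show "S \<le> C" by (simp add: cos_45 sin_45)
    show "C \<le> 1" by (simp add: C_def)
  qed
  have closedZ: "closed Z"
  proof -
    have "Z = {z. - (3 * b) \<le> fst z} \<inter> {z. fst z \<le> 3 * b}
       \<inter> {z. \<bar>(snd z - x) \<bullet> dir \<theta> - fst z * S\<bar> \<le> 5 * a / 2} \<inter> {z. \<bar>(snd z - x) \<bullet> dir (\<theta> + pi / 2) - fst z * C\<bar> \<le> d / 2}"
      by (auto simp: Z_def memT)
    then show ?thesis by (auto intro!: closed_Int closed_Collect_le continuous_intros)
  qed
  then have "Z \<in> sets borel" by (rule borel_closed)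
  then have [measurable]: "Z \<in> sets (borel \<Otimes>\<^sub>M borel)" by (subst borel_prod)
  \<comment> \<open>Relative to \<open>x\<close>, a point of the rectangle has coordinates
    \<open>s\<close>, \<open>q\<close> with \<open>\<bar>s\<bar> \<le> a\<close> and
    \<open>\<bar>q\<bar> \<le> b\<close>. The width condition holds for \<open>t\<close> in an
    interval of length \<open>d / C\<close>, which is at least \<open>d\<close>. There
    \<open>\<bar>t\<bar> * C\<close> is at most \<open>b + d / 2 \<le> 3 / 2 * b\<close>, and the
    length condition follows from \<open>a + 3 / 2 * a = 5 * a / 2\<close>.\<close>
  have slice: "ennreal d * indicator (rect c \<theta> a b) y \<le> (\<integral>\<^sup>+ t. indicator Z (t, y) \<partial>lborel)" for y
  proof (cases "y \<in> rect c \<theta> a b")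
    case True
    define s q where "s = (y - x) \<bullet> dir \<theta>" and "q = (y - x) \<bullet> dir (\<theta> + pi / 2)"
    have "\<bar>s\<bar> \<le> a" "\<bar>q\<bar> \<le> b"
    proof -
      have "s = (y - c) \<bullet> dir \<theta> - (x - c) \<bullet> dir \<theta>"
        "q = (y - c) \<bullet> dir (\<theta> + pi / 2) - (x - c) \<bullet> dir (\<theta> + pi / 2)"
        by (simp_all add: s_def q_def inner_diff_left)
      then show "\<bar>s\<bar> \<le> a" "\<bar>q\<bar> \<le> b"
        using True x by (auto simp: mem_rect_iff abs_le_iff)
    qed
    have "{(q - d / 2) / C..(q + d / 2) / C} \<subseteq> {t. (t, y) \<in> Z}"
    proof
      fix t assume "t \<in> {(q - d / 2) / C..(q + d / 2) / C}"
      then have t: "q - d / 2 \<le> t * C" "t * C \<le> q + d / 2"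
        using C by (auto simp: field_simps)
      then have tC: "\<bar>t\<bar> * C \<le> 3 / 2 * b"
        using \<open>\<bar>q\<bar> \<le> b\<close> d C by (simp add: abs_mult[symmetric, of t C, simplified] abs_if split: if_splits)
      have "\<bar>t\<bar> * (1 / 2) \<le> \<bar>t\<bar> * C" using C by (intro mult_left_mono) auto
      then have t_le: "\<bar>t\<bar> \<le> 3 * b" using tC by simp
      have "\<bar>t * S\<bar> \<le> 3 / 2 * a"
      proof -
        have "\<bar>t * S\<bar> \<le> \<bar>t\<bar> * C" using C by (simp add: abs_mult mult_left_mono)
        then show ?thesis using tC d by simp
      qed
      have "\<bar>s - t * S\<bar> \<le> 5 * a / 2"
        using \<open>\<bar>t * S\<bar> \<le> 3 / 2 * a\<close> \<open>\<bar>s\<bar> \<le> a\<close> by linarith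
      moreover have "\<bar>q - t * C\<bar> \<le> d / 2" using t by linarith
      ultimately show "t \<in> {t. (t, y) \<in> Z}"
        using t_le unfolding Z_def memT s_def q_def by (simp add: abs_le_iff)
    qed
    then have "(\<integral>\<^sup>+ t. indicator {(q - d / 2) / C..(q + d / 2) / C} t \<partial>lborel) \<le> (\<integral>\<^sup>+ t. indicator Z (t, y) \<partial>lborel)"
      by (intro nn_integral_mono) (auto simp: indicator_def)
    moreover have "(q - d / 2) / C \<le> (q + d / 2) / C" using C d by (intro divide_right_mono) auto
    moreover have "(q + d / 2) / C - (q - d / 2) / C = d / C" using C by (simp add: field_simps)
    moreover have "d \<le> d / C" using C d by (simp add: field_simps)
    ultimately have "ennreal d \<le> (\<integral>\<^sup>+ t. indicator Z (t, y) \<partial>lborel)"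
      using order_trans[OF ennreal_leI] by simp
    then show ?thesis using True by simp
  qed simp
  have "ennreal d * (\<integral>\<^sup>+ y \<in> rect c \<theta> a b. F y \<partial>lborel) = (\<integral>\<^sup>+ y. ennreal d * (F y * indicator (rect c \<theta> a b) y) \<partial>lborel)"
    by (rule nn_integral_cmult[symmetric]) measurable
  also have "\<dots> \<le> (\<integral>\<^sup>+ y. \<integral>\<^sup>+ t. F y * indicator Z (t, y) \<partial>lborel \<partial>lborel)"
  proof (intro nn_integral_mono)
    fix y
    have "F y * (ennreal d * indicator (rect c \<theta> a b) y) \<le> F y * (\<integral>\<^sup>+ t. indicator Z (t, y) \<partial>lborel)"
      by (intro mult_left_mono slice) simp
    then show "ennreal d * (F y * indicator (rect c \<theta> a b) y) \<le> (\<integral>\<^sup>+ t. F y * indicator Z (t, y) \<partial>lborel)"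
      by (subst nn_integral_cmult) (auto simp: ac_simps)
  qed
  also have "\<dots> = (\<integral>\<^sup>+ t. \<integral>\<^sup>+ y. F y * indicator Z (t, y) \<partial>lborel \<partial>lborel)"
    by (rule lborel_pair.Fubini') measurable
  also have "\<dots> = (\<integral>\<^sup>+ t \<in> {- (3 * b)..3 * b}. (\<integral>\<^sup>+ y \<in> T t. F y \<partial>lborel) \<partial>lborel)"
    by (intro nn_integral_cong) (auto simp: Z_def indicator_def)
  finally show ?thesis unfolding T_def .
qed

section \<open>Domination by the vertical maximal function\<close>

text \<open>A variant of the maximal function that is lower semicontinuous, hence Borel.\<close>

definition interior_maximal :: "plane set set \<Rightarrow> (plane \<Rightarrow> ennreal) \<Rightarrow> plane \<Rightarrow> ennreal" where
  "interior_maximal B F z =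
     (SUP r \<in> {r \<in> homothets B. z \<in> interior r}. (\<integral>\<^sup>+ y \<in> r. F y \<partial>lborel) / emeasure lborel r)"

text \<open>However large the family, each superlevel set is a union of interiors and therefore
  open.\<close>

lemma borel_measurable_interior_maximal [measurable]: "interior_maximal B F \<in> borel_measurable borel"
proof (rule borel_measurableI_greater)
  fix l
  have "{z \<in> space borel. l < interior_maximal B F z}
      = (\<Union>r\<in>{r \<in> homothets B. l < (\<integral>\<^sup>+ y \<in> r. F y \<partial>lborel) / emeasure lborel r}. interior r)"
    by (auto simp: interior_maximal_def less_SUP_iff)
  then show "{z \<in> space borel. l < interior_maximal B F z} \<in> sets borel"
    by (auto intro!: borel_open)
qed

text \<open>Scaling by \<open>A / a\<close> keeps the direction and the ratio of the sides, so the
  centred rectangle is a homothet of the given member of \<open>B\<close> and competes at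
  \<open>z\<close>.\<close>

lemma nn_integral_centered_rect_le:
  assumes r: "rect c \<theta> a b \<in> B" and ab: "0 < a" "0 < b" and A: "0 < A" and \<theta>: "0 < cos \<theta>"
  shows "(\<integral>\<^sup>+ y \<in> centered_rect z \<theta> A (A * (b / a)). F y \<partial>lborel)
           \<le> ennreal (A * (A * (b / a))) * interior_maximal B F z"
proof -
  define T where "T = centered_rect z \<theta> A (A * (b / a))"
  define k where "k = z - (A / 2) *\<^sub>R dir \<theta> - (A * (b / a) / 2) *\<^sub>R dir (\<theta> + pi / 2)"
  have "T = (\<lambda>x. (k - (A / a) *\<^sub>R c) + (A / a) *\<^sub>R x) ` rect c \<theta> a b"
    using ab A by (subst homothety_rect) (auto simp: T_def centered_rect_def k_def)
  moreover have "0 < A / a" using ab A by simp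
  ultimately have "T \<in> homothets B" using r unfolding homothets_def by blast
  moreover have "z \<in> interior T" unfolding T_def using ab A by (intro center_in_interior) auto
  ultimately have "(\<integral>\<^sup>+ y \<in> T. F y \<partial>lborel) / emeasure lborel T \<le> interior_maximal B F z"
    unfolding interior_maximal_def by (intro SUP_upper) auto
  moreover have m: "emeasure lborel T = ennreal (A * (A * (b / a)))"
    unfolding T_def centered_rect_def using \<theta> ab A by (intro emeasure_rect) auto
  ultimately have "ennreal (A * (A * (b / a))) * ((\<integral>\<^sup>+ y \<in> T. F y \<partial>lborel) / ennreal (A * (A * (b / a))))
      \<le> ennreal (A * (A * (b / a))) * interior_maximal B F z"
    by (intro mult_left_mono) auto
  also have "ennreal (A * (A * (b / a))) * ((\<integral>\<^sup>+ y \<in> T. F y \<partial>lborel) / ennreal (A * (A * (b / a))))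
      = (\<integral>\<^sup>+ y \<in> T. F y \<partial>lborel)"
    using ab A by (simp add: ennreal_times_divide ennreal_mult_divide_eq mult.commute[of "ennreal _"])
  finally show ?thesis unfolding T_def .
qed

text \<open>Each thin translate is controlled by \<open>interior_maximal\<close> at its centre, so
  the sweeping estimate bounds the integral over the fat rectangle by a vertical window integral.
  The thin area \<open>5 * a * d\<close> and a window of length at most \<open>12 * b\<close> give
  60 = 5 * 12. The width \<open>d\<close> cancels, so the constant is independent of it.\<close>

lemma rect_average_le_hl_max:
  fixes F :: "plane \<Rightarrow> ennreal"
  assumes F [measurable]: "F \<in> borel_measurable borel"
    and \<theta>: "0 \<le> \<theta>" "\<theta> \<le> pi / 4" and ab: "0 < b" "b \<le> a" and x: "x \<in> rect c \<theta> a b"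
    and thin: "\<And>e. 0 < e \<Longrightarrow> \<exists>c' a' b'. 0 < b' \<and> b' \<le> a' \<and> b' / a' < e \<and> rect c' \<theta> a' b' \<in> B"
  shows "(\<integral>\<^sup>+ y \<in> rect c \<theta> a b. F y \<partial>lborel) / emeasure lborel (rect c \<theta> a b)
           \<le> 60 * hl_max (\<lambda>t. interior_maximal B F (fst x, t)) (snd x)"
proof -
  define h where "h = (\<lambda>t. interior_maximal B F (fst x, t))"
  have [measurable]: "h \<in> borel_measurable borel" unfolding h_def by measurable
  have cos_pos: "0 < cos \<theta>" using \<theta> pi_gt_zero by (intro cos_gt_zero_pi; linarith)
  \<comment> \<open>With eccentricity below \<open>b / (5 * a)\<close>, the homothet of length
    \<open>5 * a\<close> is at most \<open>b\<close> wide.\<close>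
  obtain c' a' b' where r: "0 < b'" "b' \<le> a'" "b' / a' < b / (5 * a)" "rect c' \<theta> a' b' \<in> B"
    using thin[of "b / (5 * a)"] ab by auto
  define d where "d = 5 * a * (b' / a')"
  have d: "0 < d" "d \<le> b"
  proof -
    show "0 < d" using r ab by (simp add: d_def)
    have "d \<le> 5 * a * (b / (5 * a))" unfolding d_def using r ab by (intro mult_left_mono) auto
    then show "d \<le> b" using ab by simp
  qed
  \<comment> \<open>\<open>hl_max\<close> admits only rational radii. The lower bound covers the
    sweeping window, the upper one keeps \<open>2 * \<rho>\<close> below
    \<open>12 * b\<close>.\<close>
  obtain \<rho> where \<rho>: "\<rho> \<in> \<rat>" "3 * b < \<rho>" "\<rho> < 6 * b"
    using Rats_dense_in_real[of "3 * b" "6 * b"] ab by auto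
  define I where "I = (\<integral>\<^sup>+ t \<in> {-\<rho>..\<rho>}. h (snd x + t) \<partial>lborel)"
  have hl: "I \<le> ennreal (2 * \<rho>) * hl_max h (snd x)"
  proof -
    have "I / ennreal (2 * \<rho>) \<le> hl_max h (snd x)"
      unfolding hl_max_def I_def by (rule SUP_upper) (use \<rho> ab in auto)
    then have "ennreal (2 * \<rho>) * (I / ennreal (2 * \<rho>)) \<le> ennreal (2 * \<rho>) * hl_max h (snd x)"
      by (rule mult_left_mono) simp
    moreover have "ennreal (2 * \<rho>) * (I / ennreal (2 * \<rho>)) = I"
      using \<rho> ab by (simp add: ennreal_times_divide ennreal_mult_divide_eq mult.commute[of "ennreal _"])
    ultimately show ?thesis by simp
  qed
  have "ennreal d * (\<integral>\<^sup>+ y \<in> rect c \<theta> a b. F y \<partial>lborel)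
      \<le> (\<integral>\<^sup>+ t \<in> {- (3 * b)..3 * b}. (\<integral>\<^sup>+ y \<in> centered_rect (x + (0, t)) \<theta> (5 * a) d. F y \<partial>lborel) \<partial>lborel)"
    by (rule nn_integral_rect_le_thin_translates) (use \<theta> d ab x in auto)
  also have "\<dots> \<le> (\<integral>\<^sup>+ t. ennreal (5 * a * d) * (h (snd x + t) * indicator {-\<rho>..\<rho>} t) \<partial>lborel)"
  proof (intro nn_integral_mono)
    fix t
    have "x + (0, t) = (fst x, snd x + t)" by (cases x) simp
    moreover have "(\<integral>\<^sup>+ y \<in> centered_rect (x + (0, t)) \<theta> (5 * a) d. F y \<partial>lborel)
        \<le> ennreal (5 * a * d) * interior_maximal B F (x + (0, t))"
      unfolding d_def by (rule nn_integral_centered_rect_le[OF r(4)]) (use r ab cos_pos in auto)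
    ultimately show "(\<integral>\<^sup>+ y \<in> centered_rect (x + (0, t)) \<theta> (5 * a) d. F y \<partial>lborel) * indicator {- (3 * b)..3 * b} t
        \<le> ennreal (5 * a * d) * (h (snd x + t) * indicator {-\<rho>..\<rho>} t)"
      using \<rho> by (auto simp: indicator_def h_def)
  qed
  also have "\<dots> = ennreal (5 * a * d) * I"
    unfolding I_def by (rule nn_integral_cmult) measurable
  also have "\<dots> \<le> ennreal (5 * a * d) * (ennreal (2 * \<rho>) * hl_max h (snd x))"
    by (intro mult_left_mono hl) simp
  also have "\<dots> \<le> ennreal (60 * a * b * d) * hl_max h (snd x)"
  proof -
    have "5 * a * d * (2 * \<rho>) \<le> 5 * a * d * (12 * b)"
      using \<rho> ab d by (intro mult_left_mono) auto
    then have "ennreal (5 * a * d) * ennreal (2 * \<rho>) \<le> ennreal (60 * a * b * d)"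
      using \<rho> ab d by (simp add: ennreal_mult'[symmetric] algebra_simps ennreal_leI)
    then show ?thesis unfolding mult.assoc[symmetric] by (rule mult_right_mono) simp
  qed
  also have "\<dots> = ennreal d * (ennreal (a * b) * (60 * hl_max h (snd x)))"
  proof -
    have "ennreal (60 * a * b * d) = ennreal d * (ennreal (a * b) * 60)"
      using ab d by (simp add: ennreal_mult'[symmetric] mult.commute mult.left_commute flip: ennreal_numeral)
    then show ?thesis by (simp add: mult.assoc)
  qed
  finally have le: "(\<integral>\<^sup>+ y \<in> rect c \<theta> a b. F y \<partial>lborel) \<le> ennreal (a * b) * (60 * hl_max h (snd x))"
    using d by (simp add: ennreal_mult_le_mult_iff)
  have m: "emeasure lborel (rect c \<theta> a b) = ennreal (a * b)"
    using cos_pos ab by (intro emeasure_rect) auto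
  have "(\<integral>\<^sup>+ y \<in> rect c \<theta> a b. F y \<partial>lborel) / ennreal (a * b) \<le> ennreal (a * b) * (60 * hl_max h (snd x)) / ennreal (a * b)"
    using le by (rule divide_right_mono_ennreal)
  also have "\<dots> = 60 * hl_max h (snd x)"
    using ab by (subst mult.commute) (simp add: ennreal_mult_divide_eq)
  finally show ?thesis unfolding m h_def .
qed

text \<open>The one-dimensional constant is the same on every vertical line, so the bound can be
  integrated over the abscissa by Tonelli.\<close>

lemma hl_max_vertical_strong_type:
  fixes h :: "plane \<Rightarrow> ennreal"
  assumes h [measurable]: "h \<in> borel_measurable borel" and p: "1 < p"
  shows "(\<integral>\<^sup>+ x. ennreal_powr (hl_max (\<lambda>t. h (fst x, t)) (snd x)) p \<partial>lborel)
           \<le> ennreal (10 * p / (p - 1) * 2 powr (p - 1)) * (\<integral>\<^sup>+ x. ennreal_powr (h x) p \<partial>lborel)"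
    and "(\<lambda>x. hl_max (\<lambda>t. h (fst x, t)) (snd x)) \<in> borel_measurable borel"
proof -
  have [measurable]: "h \<in> borel_measurable (borel \<Otimes>\<^sub>M borel)" using h by (simp add: borel_prod)
  have *: "(\<lambda>x. hl_max (\<lambda>t. h (fst x, t)) (snd x)) \<in> borel_measurable (borel \<Otimes>\<^sub>M borel)"
    unfolding hl_max_def by (intro borel_measurable_SUP countable_pos_rats) measurable
  then show "(\<lambda>x. hl_max (\<lambda>t. h (fst x, t)) (snd x)) \<in> borel_measurable borel"
    by (simp add: borel_prod)
  from * have **: "(\<lambda>x. ennreal_powr (hl_max (\<lambda>t. h (fst x, t)) (snd x)) p) \<in> borel_measurable (lborel \<Otimes>\<^sub>M lborel)"
    by measurable
  have hp: "(\<lambda>x. ennreal_powr (h x) p) \<in> borel_measurable (lborel \<Otimes>\<^sub>M lborel)" by measurable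
  let ?K = "ennreal (10 * p / (p - 1) * 2 powr (p - 1))"
  have "(\<integral>\<^sup>+ x. ennreal_powr (hl_max (\<lambda>t. h (fst x, t)) (snd x)) p \<partial>lborel)
      = (\<integral>\<^sup>+ u. \<integral>\<^sup>+ v. ennreal_powr (hl_max (\<lambda>t. h (u, t)) v) p \<partial>lborel \<partial>lborel)"
    using lborel.nn_integral_fst[OF **] by (simp add: lborel_prod)
  also have "\<dots> \<le> (\<integral>\<^sup>+ u. ?K * (\<integral>\<^sup>+ v. ennreal_powr (h (u, v)) p \<partial>lborel) \<partial>lborel)"
    by (intro nn_integral_mono hl_max_strong_type p) measurable
  also have "\<dots> = ?K * (\<integral>\<^sup>+ u. \<integral>\<^sup>+ v. ennreal_powr (h (u, v)) p \<partial>lborel \<partial>lborel)"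
    by (rule nn_integral_cmult) measurable
  also have "(\<integral>\<^sup>+ u. \<integral>\<^sup>+ v. ennreal_powr (h (u, v)) p \<partial>lborel \<partial>lborel) = (\<integral>\<^sup>+ x. ennreal_powr (h x) p \<partial>lborel)"
    using lborel.nn_integral_fst[OF hp] by (simp add: lborel_prod)
  finally show "(\<integral>\<^sup>+ x. ennreal_powr (hl_max (\<lambda>t. h (fst x, t)) (snd x)) p \<partial>lborel)
           \<le> ?K * (\<integral>\<^sup>+ x. ennreal_powr (h x) p \<partial>lborel)" .
qed

section \<open>Comparison of the two maximal operators and their norms\<close>

lemma homothets_along_cases:
  assumes "r \<in> homothets (rectangles_along \<Omega>)"
  obtains c \<omega> a b where "\<omega> \<in> \<Omega>" "0 < b" "b \<le> a" "r = rect c \<omega> a b"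
proof -
  from assms obtain t h r0 where r0: "r = (\<lambda>x. t + h *\<^sub>R x) ` r0" "0 < h" "r0 \<in> rectangles" "orientation r0 \<in> \<Omega>"
    by (auto simp: homothets_def rectangles_along_def)
  from rectangle_as_rect[OF r0(3)] obtain c a b where "0 < b" "b \<le> a" "r0 = rect c (orientation r0) a b" .
  with r0 that[of "orientation r0" "h * b" "h * a" "t + h *\<^sub>R c"] homothety_rect[of h t c "orientation r0" a b]
  show ?thesis by (auto simp: mult_left_mono)
qed

lemma maximal_op_along_le:
  assumes F [measurable]: "F \<in> borel_measurable borel" and fF: "AE y in lborel. ennreal \<bar>f y\<bar> = F y"
    and \<Omega>: "\<Omega> \<subseteq> {0..<pi / 4}" and B: "B \<subseteq> rectangles_along \<Omega>"
    and thin: "\<And>\<omega>. \<omega> \<in> \<Omega> \<Longrightarrow> (INF r \<in> {r \<in> B. orientation r = \<omega>}. ereal (eccentricity r)) = 0"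
  shows "maximal_op (rectangles_along \<Omega>) f x
           \<le> 60 * hl_max (\<lambda>t. interior_maximal B F (fst x, t)) (snd x)"
  unfolding maximal_op_def
proof (rule SUP_least, clarify)
  fix r assume r: "r \<in> homothets (rectangles_along \<Omega>)" and xr: "x \<in> r"
  from homothets_along_cases[OF r] obtain c \<omega> a b
    where \<omega>: "\<omega> \<in> \<Omega>" and ab: "0 < b" "b \<le> a" and r_eq: "r = rect c \<omega> a b" .
  \<comment> \<open>In \<open>ereal\<close> the infimum over an empty family is \<infinity>, so the
    value 0 really provides members of \<open>B\<close> in direction \<open>\<omega>\<close>, of
    arbitrarily small eccentricity.\<close>
  have thin': "\<exists>c' a' b'. 0 < b' \<and> b' \<le> a' \<and> b' / a' < e \<and> rect c' \<omega> a' b' \<in> B" if "0 < e" for e :: real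
  proof -
    have "(INF r \<in> {r \<in> B. orientation r = \<omega>}. ereal (eccentricity r)) < ereal e"
      using thin[OF \<omega>] that by simp
    then obtain r' where r': "r' \<in> B" "orientation r' = \<omega>" "eccentricity r' < e"
      by (auto simp: INF_less_iff)
    then have "r' \<in> rectangles" using B by (auto simp: rectangles_along_def)
    from rectangle_as_rect[OF this] obtain c' a' b' where "0 < b'" "b' \<le> a'" "r' = rect c' (orientation r') a' b'" .
    with r' eccentricity_rect[of b' a' c' \<omega>] show ?thesis by metis
  qed
  have "(\<integral>\<^sup>+ y \<in> r. ennreal \<bar>f y\<bar> \<partial>lebesgue) = (\<integral>\<^sup>+ y \<in> r. F y \<partial>lborel)"
    unfolding nn_integral_completion
    by (rule nn_integral_cong_AE) (use fF in eventually_elim, simp)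
  moreover have "emeasure lebesgue r = emeasure lborel r"
    by (simp add: r_eq)
  moreover have "0 \<le> \<omega>" "\<omega> \<le> pi / 4" using \<omega> \<Omega> by auto
  ultimately show "(\<integral>\<^sup>+ y \<in> r. ennreal \<bar>f y\<bar> \<partial>lebesgue) / emeasure lebesgue r
      \<le> 60 * hl_max (\<lambda>t. interior_maximal B F (fst x, t)) (snd x)"
    using rect_average_le_hl_max[OF F _ _ ab _ thin', of x c] xr by (simp add: r_eq)
qed

text \<open>Restricting to interior points only shrinks the set of competitors; this leads back from
  the Borel auxiliary function to the operator of \<open>B\<close>.\<close>

lemma interior_maximal_le_maximal_op:
  assumes fF: "AE y in lborel. ennreal \<bar>f y\<bar> = F y" and B: "B \<subseteq> rectangles_along \<Omega>"
  shows "interior_maximal B F x \<le> maximal_op B f x"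
  unfolding interior_maximal_def
proof (rule SUP_least, clarify)
  fix r assume r: "r \<in> homothets B" and xr: "x \<in> interior r"
  have "r \<in> homothets (rectangles_along \<Omega>)"
    using r B unfolding homothets_def by blast
  then have "r \<in> sets borel" by (rule homothets_along_cases) simp
  then have "emeasure lborel r = emeasure lebesgue r" by simp
  moreover have "(\<integral>\<^sup>+ y \<in> r. F y \<partial>lborel) = (\<integral>\<^sup>+ y \<in> r. ennreal \<bar>f y\<bar> \<partial>lebesgue)"
    unfolding nn_integral_completion
    by (rule nn_integral_cong_AE) (use fF in eventually_elim, simp)
  moreover have "x \<in> r" using xr interior_subset by blast
  ultimately show "(\<integral>\<^sup>+ y \<in> r. F y \<partial>lborel) / emeasure lborel r \<le> maximal_op B f x"
    unfolding maximal_op_def using r by (auto intro!: SUP_upper2[of r])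
qed

text \<open>The Borel function \<open>h\<close> sits between the two operators: the comparisons with
  \<open>maximal_op\<close> use only monotonicity of the integral, while the steps that depend on
  measurability concern \<open>h\<close> and \<open>M\<close>.\<close>

lemma Lp_norm_maximal_op_along_le:
  assumes f: "f \<in> borel_measurable lebesgue" and p: "1 < p"
    and \<Omega>: "\<Omega> \<subseteq> {0..<pi / 4}" and B: "B \<subseteq> rectangles_along \<Omega>"
    and thin: "\<And>\<omega>. \<omega> \<in> \<Omega> \<Longrightarrow> (INF r \<in> {r \<in> B. orientation r = \<omega>}. ereal (eccentricity r)) = 0"
  shows "Lp_norm p (maximal_op (rectangles_along \<Omega>) f)
           \<le> ennreal ((60 powr p * (10 * p / (p - 1) * 2 powr (p - 1))) powr (1 / p)) * Lp_norm p (maximal_op B f)"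
proof -
  have "(\<lambda>y. ennreal \<bar>f y\<bar>) \<in> borel_measurable lebesgue" using f by measurable
  \<comment> \<open>Since \<open>f\<close> is merely Lebesgue measurable, its absolute value is
    replaced by an almost everywhere equal Borel function, which has the same averages and to which
    Fubini for Borel functions applies.\<close>
  then obtain F where "F \<in> borel_measurable lborel" and fF: "AE y in lborel. ennreal \<bar>f y\<bar> = F y"
    using completion_ex_borel_measurable by blast
  then have F [measurable]: "F \<in> borel_measurable borel" by simp
  define h where "h = interior_maximal B F"
  have h [measurable]: "h \<in> borel_measurable borel" by (simp add: h_def)
  define M where "M x = hl_max (\<lambda>t. h (fst x, t)) (snd x)" for x
  have [measurable]: "M \<in> borel_measurable borel"
    unfolding M_def by (rule hl_max_vertical_strong_type(2)[OF h p])
  let ?K = "10 * p / (p - 1) * 2 powr (p - 1)"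
  have K: "0 \<le> ?K" using p by simp
  have "(\<integral>\<^sup>+ x. ennreal_powr (maximal_op (rectangles_along \<Omega>) f x) p \<partial>lborel)
      \<le> (\<integral>\<^sup>+ x. ennreal_powr (ennreal 60 * M x) p \<partial>lborel)"
    using maximal_op_along_le[OF F fF \<Omega> B thin] p
    by (intro nn_integral_mono ennreal_powr_mono) (auto simp: M_def h_def)
  also have "\<dots> = (\<integral>\<^sup>+ x. ennreal (60 powr p) * ennreal_powr (M x) p \<partial>lborel)"
    using p by (subst ennreal_powr_mult) auto
  also have "\<dots> = ennreal (60 powr p) * (\<integral>\<^sup>+ x. ennreal_powr (M x) p \<partial>lborel)"
    by (rule nn_integral_cmult) measurable
  also have "\<dots> \<le> ennreal (60 powr p) * (ennreal ?K * (\<integral>\<^sup>+ x. ennreal_powr (h x) p \<partial>lborel))"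
    unfolding M_def by (intro mult_left_mono hl_max_vertical_strong_type h p) simp
  also have "\<dots> \<le> ennreal (60 powr p) * (ennreal ?K * (\<integral>\<^sup>+ x. ennreal_powr (maximal_op B f x) p \<partial>lborel))"
    unfolding h_def using p
    by (intro mult_left_mono nn_integral_mono ennreal_powr_mono interior_maximal_le_maximal_op[OF fF B]) auto
  also have "\<dots> = ennreal (60 powr p * ?K) * (\<integral>\<^sup>+ x. ennreal_powr (maximal_op B f x) p \<partial>lborel)"
    using K by (simp add: ennreal_mult mult.assoc del: times_divide_eq_left)
  finally have "ennreal_powr (\<integral>\<^sup>+ x. ennreal_powr (maximal_op (rectangles_along \<Omega>) f x) p \<partial>lborel) (1 / p)
      \<le> ennreal_powr (ennreal (60 powr p * ?K) * (\<integral>\<^sup>+ x. ennreal_powr (maximal_op B f x) p \<partial>lborel)) (1 / p)"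
    by (rule ennreal_powr_mono) (use p in simp)
  also have "\<dots> = ennreal ((60 powr p * ?K) powr (1 / p))
      * ennreal_powr (\<integral>\<^sup>+ x. ennreal_powr (maximal_op B f x) p \<partial>lborel) (1 / p)"
    by (rule ennreal_powr_mult) (use K p in auto)
  finally show ?thesis by (simp add: Lp_norm_def nn_integral_completion)
qed

theorem theorem6:
  fixes \<Omega> :: "real set" and B :: "plane set set"
  assumes "\<Omega> \<subseteq> {0..<pi / 4}"
    and "bad_directions \<Omega>"
    and "B \<subseteq> rectangles_along \<Omega>"
    and "\<And>\<omega>. \<omega> \<in> \<Omega> \<Longrightarrow> (INF r \<in> {r \<in> B. orientation r = \<omega>}. ereal (eccentricity r)) = 0"
  shows "bad_maximal_op B"
  unfolding bad_maximal_op_def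
proof (intro allI impI notI)
  fix p :: real assume p: "1 < p" and "bounded_on_Lp p B"
  then have fin: "maximal_op_norm p B < \<infinity>" by (simp add: bounded_on_Lp_def)
  define K where "K = (60 powr p * (10 * p / (p - 1) * 2 powr (p - 1))) powr (1 / p)"
  \<comment> \<open>\<open>K\<close> depends only on \<open>p\<close>, so the estimate survives the
    supremum over all normalised \<open>f\<close>.\<close>
  have "maximal_op_norm p (rectangles_along \<Omega>) \<le> ennreal K * maximal_op_norm p B"
    unfolding maximal_op_norm_def[of p "rectangles_along \<Omega>"]
  proof (rule SUP_least)
    fix f :: "plane \<Rightarrow> real"
    assume f: "f \<in> {f \<in> borel_measurable lebesgue. Lp_norm p (\<lambda>x. ennreal \<bar>f x\<bar>) = 1}"
    then have "Lp_norm p (maximal_op (rectangles_along \<Omega>) f) \<le> ennreal K * Lp_norm p (maximal_op B f)"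
      unfolding K_def by (intro Lp_norm_maximal_op_along_le p assms) auto
    also have "\<dots> \<le> ennreal K * maximal_op_norm p B"
      unfolding maximal_op_norm_def by (intro mult_left_mono SUP_upper f) simp
    finally show "Lp_norm p (maximal_op (rectangles_along \<Omega>) f) \<le> ennreal K * maximal_op_norm p B" .
  qed
  also have "\<dots> < \<infinity>" using fin by (simp add: ennreal_mult_less_top)
  finally have "bounded_on_Lp p (rectangles_along \<Omega>)" by (simp add: bounded_on_Lp_def)
  with assms(2) p show False by (auto simp: bad_directions_def bad_maximal_op_def)
qed

end
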